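(* Fix $R>0$. For each $n$ let $K_n$ be a positive integer and $0=t_0<t_1<\dots<t_{K_n}=1$ (possibly depending on $n$). Let $g$ be a fixed Lebesgue density on $\mathbb{R}$ that is positive and $\beta$-Hölder continuous for some $0<\beta\le1$, and consider the prior on $\mathbf{a}=(a_1,\dots,a_{K_n})\in\mathbb{R}^{K_n}$ with Lebesgue density $\pi(\mathbf{a})=\prod_{j=1}^{K_n}g(a_j)$, with $\mathbf{a}$ parametrizing $f=\sum_{j=1}^{K_n}a_j\mathbf{1}_{[t_{j-1},t_j)}$. If $$n\,\frac{\inf_{j=1,\dots,K_n}|t_j-t_{j-1}|}{K_n^{1/\beta}\log(K_n)}\to\infty,$$ then $$\sup_{f_0\in \mathrm{PC}^*(K_n,(t_0,\dots,t_{K_n}),R)}E_{f_0}\big[\|\Pi(\cdot\mid N)-Q^n\|_{\mathrm{TV}}\big]\to0\quad\text{as }n\to\infty.$$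
   Context: Model: $P_f$ (expectation $E_f$) is the law of a Poisson point process $N=\sum_i\delta_{(X_i,Y_i)}$ on $[0,1]\times\mathbb{R}$ with intensity $n\mathbf{1}(f(x)\le y)$ with respect to Lebesgue measure. $\mathrm{PC}^*(K,(t_0,\dots,t_K),R)=\{f=\sum_{j=1}^K a_j\mathbf{1}_{[t_{j-1},t_j)}:|a_j|\le R\}$. The posterior $\Pi(\cdot\mid N)$ on $(\mathbb{R}^{K_n},\mathcal{B}(\mathbb{R}^{K_n}))$ is, with $f_{\mathbf{a}}=\sum_j a_j\mathbf{1}_{[t_{j-1},t_j)}$, $$\Pi(B\mid N)=\frac{\int_B e^{n\int_0^1 f_{\mathbf{a}}}\mathbf{1}(\forall i:f_{\mathbf{a}}(X_i)\le Y_i)\prod_j g(a_j)\,d\mathbf{a}}{\int_{\mathbb{R}^{K_n}}e^{n\int_0^1 f_{\mathbf{a}}}\mathbf{1}(\forall i:f_{\mathbf{a}}(X_i)\le Y_i)\prod_jg(a_j)\,d\mathbf{a}}.$$ Let $\widehat a_j=\min_{i:X_i\in[t_{j-1},t_j)}Y_i$. $Q^n$ is, for given $(\widehat a_1,\dots,\widehat a_{K_n})$, the distribution on $\mathbb{R}^{K_n}$ of $(\widehat a_1-\eta_1,\dots,\widehat a_{K_n}-\eta_{K_n})$, where the $\eta_j\sim\mathrm{Exp}(n(t_j-t_{j-1}))$ (rate parametrization, mean $1/(n(t_j-t_{j-1}))$) are independent of each other and of the data. $\|P-Q\|_{\mathrm{TV}}=\sup_B|P(B)-Q(B)|$. *)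

theory Defs
  imports "HOL-Probability.Probability"
begin

section \<open>Poisson point processes\<close>

text \<open>
  A point configuration with infinitely many points is given by an enumeration
  \<open>z :: nat \<Rightarrow> 'a\<close> of its points, in arbitrary order and with repetitions allowed.
  \<open>count_points z A\<close> is the mass that \<open>\<Sum>\<^sub>i \<delta>(z\<^sub>i)\<close> gives to \<open>A\<close>.
\<close>

definition count_points :: "(nat \<Rightarrow> 'a) \<Rightarrow> 'a set \<Rightarrow> ennreal" where
  "count_points z A = emeasure (count_space UNIV) {i. z i \<in> A}"

text \<open>
  \<open>M\<close> is the underlying probability space and \<open>Z i\<close> the \<open>i\<close>-th point. Enumerating the points by
  \<open>nat\<close> presupposes an intensity measure \<open>\<Lambda>\<close> of infinite total mass, in which case a
  Poisson point process has infinitely many points almost surely.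
\<close>

definition poisson_point_process ::
  "'w measure \<Rightarrow> (nat \<Rightarrow> 'w \<Rightarrow> 'a) \<Rightarrow> 'a measure \<Rightarrow> bool" where
  "poisson_point_process M Z \<Lambda> \<longleftrightarrow>
     prob_space M \<and>
     (\<forall>i. Z i \<in> M \<rightarrow>\<^sub>M \<Lambda>) \<and>
     (\<forall>A\<in>sets \<Lambda>. emeasure \<Lambda> A < \<infinity> \<longrightarrow>
        (\<forall>k. measure M {\<omega>\<in>space M. count_points (\<lambda>i. Z i \<omega>) A = of_nat k} =
             measure \<Lambda> A ^ k / fact k * exp (- measure \<Lambda> A))) \<and>
     (\<forall>A\<in>sets \<Lambda>. emeasure \<Lambda> A = \<infinity> \<longrightarrow>
        (AE \<omega> in M. count_points (\<lambda>i. Z i \<omega>) A = \<infinity>)) \<and>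
     (\<forall>(A :: nat \<Rightarrow> 'a set) m.
        (\<forall>l<m. A l \<in> sets \<Lambda>) \<longrightarrow> disjoint_family_on A {..<m} \<longrightarrow>
        prob_space.indep_vars M (\<lambda>_. borel) (\<lambda>l \<omega>. count_points (\<lambda>i. Z i \<omega>) (A l)) {..<m})"

definition boundary_intensity :: "nat \<Rightarrow> (real \<Rightarrow> real) \<Rightarrow> (real \<times> real) measure" where
  "boundary_intensity n f =
     density (restrict_space lborel ({0..1} \<times> UNIV))
       (\<lambda>(x, y). ennreal (real n * (if f x \<le> y then 1 else 0)))"


section \<open>Piecewise constant functions\<close>

definition step_function :: "nat \<Rightarrow> (nat \<Rightarrow> real) \<Rightarrow> (nat \<Rightarrow> real) \<Rightarrow> real \<Rightarrow> real" where
  "step_function K t a x = (\<Sum>j=1..K. a j * indicator {t (j - 1)..<t j} x)"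

definition PC_star :: "nat \<Rightarrow> (nat \<Rightarrow> real) \<Rightarrow> real \<Rightarrow> (real \<Rightarrow> real) set" where
  "PC_star K t R = {step_function K t a | a. \<forall>j\<in>{1..K}. \<bar>a j\<bar> \<le> R}"


section \<open>Posterior and limit distribution\<close>

text \<open>
  \<open>\<real>\<^sup>K\<close> with its Borel sets is the space of functions on \<open>{1..K}\<close> (extended by
  \<open>undefined\<close>), with the product Lebesgue measure.
\<close>

abbreviation lebesgue_prod :: "nat \<Rightarrow> (nat \<Rightarrow> real) measure" where
  "lebesgue_prod K \<equiv> Pi\<^sub>M {1..K} (\<lambda>_. lborel)"

definition posterior_weight ::
  "nat \<Rightarrow> (real \<Rightarrow> real) \<Rightarrow> nat \<Rightarrow> (nat \<Rightarrow> real) \<Rightarrow> (nat \<Rightarrow> real \<times> real) \<Rightarrow> (nat \<Rightarrow> real) \<Rightarrow> real" where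
  "posterior_weight n g K t z a =
     exp (real n * (LBINT x:{0..1}. step_function K t a x)) *
     (if \<forall>i. step_function K t a (fst (z i)) \<le> snd (z i) then 1 else 0) *
     (\<Prod>j=1..K. g (a j))"

definition posterior ::
  "nat \<Rightarrow> (real \<Rightarrow> real) \<Rightarrow> nat \<Rightarrow> (nat \<Rightarrow> real) \<Rightarrow> (nat \<Rightarrow> real \<times> real) \<Rightarrow> (nat \<Rightarrow> real) measure" where
  "posterior n g K t z =
     density (lebesgue_prod K)
       (\<lambda>a. ennreal (posterior_weight n g K t z a) /
            (\<integral>\<^sup>+ b. ennreal (posterior_weight n g K t z b) \<partial>lebesgue_prod K))"

lemma measurable_posterior_weight:
  assumes [measurable]: "g \<in> borel_measurable borel"
  shows "posterior_weight n g K t z \<in> borel_measurable (lebesgue_prod K)"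
proof -
  have int: "(LBINT x:{0..1}. step_function K t a x) =
      (\<Sum>j=1..K. a j * measure lborel ({0..1} \<inter> {t (j - 1)..<t j}))" for a
  proof -
    have fin: "emeasure lborel ({0..1} \<inter> {t (j - 1)..<t j}) < \<infinity>" for j
    proof -
      have "emeasure lborel ({0..1} \<inter> {t (j - 1)..<t j}) \<le> emeasure lborel {0..1::real}"
        by (rule emeasure_mono) auto
      then show ?thesis by (auto intro: le_less_trans)
    qed
    have "(LBINT x:{0..1}. step_function K t a x) =
        (\<integral>x. (\<Sum>j=1..K. a j * indicator ({0..1} \<inter> {t (j - 1)..<t j}) x) \<partial>lborel)"
      unfolding set_lebesgue_integral_def step_function_def
      by (intro Bochner_Integration.integral_cong refl)
        (simp only: real_scaleR_def sum_distrib_left indicator_inter_arith mult.left_commute)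
    also have "\<dots> = (\<Sum>j=1..K. \<integral>x. a j * indicator ({0..1} \<inter> {t (j - 1)..<t j}) x \<partial>lborel)"
      by (rule Bochner_Integration.integral_sum)
        (use fin in \<open>auto intro!: integrable_mult_right integrable_real_indicator\<close>)
    also have "\<dots> = (\<Sum>j=1..K. a j * measure lborel ({0..1} \<inter> {t (j - 1)..<t j}))"
      by simp
    finally show ?thesis .
  qed
  show ?thesis
    unfolding posterior_weight_def int unfolding step_function_def by measurable
qed

lemma emeasure_posterior:
  assumes "g \<in> borel_measurable borel" "B \<in> sets (lebesgue_prod K)"
  shows "emeasure (posterior n g K t z) B =
    (\<integral>\<^sup>+ a\<in>B. ennreal (posterior_weight n g K t z a) \<partial>lebesgue_prod K) /
    (\<integral>\<^sup>+ a. ennreal (posterior_weight n g K t z a) \<partial>lebesgue_prod K)"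
proof -
  let ?w = "\<lambda>a. ennreal (posterior_weight n g K t z a)"
  let ?D = "\<integral>\<^sup>+ b. ?w b \<partial>lebesgue_prod K"
  note [measurable] = measurable_posterior_weight[OF assms(1)] assms(2)
  have "emeasure (posterior n g K t z) B = (\<integral>\<^sup>+ a. ?w a / ?D * indicator B a \<partial>lebesgue_prod K)"
    unfolding posterior_def by (rule emeasure_density) measurable
  also have "\<dots> = (\<integral>\<^sup>+ a. (?w a * indicator B a) * inverse ?D \<partial>lebesgue_prod K)"
    by (simp only: divide_ennreal_def mult_ac)
  also have "\<dots> = (\<integral>\<^sup>+ a\<in>B. ?w a \<partial>lebesgue_prod K) * inverse ?D"
    by (rule nn_integral_multc) measurable
  finally show ?thesis
    by (simp only: divide_ennreal_def)
qed

text \<open>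
  Almost surely the set of ordinates below is infinite and bounded below, and the infimum is
  attained, i.e. it is the minimum. (\<open>Min\<close> is only usable for finite sets.)
\<close>

definition a_hat :: "(nat \<Rightarrow> real) \<Rightarrow> (nat \<Rightarrow> real \<times> real) \<Rightarrow> nat \<Rightarrow> real" where
  "a_hat t z j = (INF i\<in>{i. fst (z i) \<in> {t (j - 1)..<t j}}. snd (z i))"

definition shifted_exponential ::
  "nat \<Rightarrow> nat \<Rightarrow> (nat \<Rightarrow> real) \<Rightarrow> (nat \<Rightarrow> real \<times> real) \<Rightarrow> (nat \<Rightarrow> real) measure" where
  "shifted_exponential n K t z =
     distr
       (Pi\<^sub>M {1..K} (\<lambda>j. density lborel (exponential_density (real n * (t j - t (j - 1))))))
       (lebesgue_prod K)
       (\<lambda>\<eta>. \<lambda>j\<in>{1..K}. a_hat t z j - \<eta> j)"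

definition tv_norm :: "'a measure \<Rightarrow> 'a measure \<Rightarrow> real" where
  "tv_norm P Q = (SUP B\<in>sets P. \<bar>measure P B - measure Q B\<bar>)"


section \<open>Hoelder continuity\<close>

definition hoelder_continuous :: "real \<Rightarrow> (real \<Rightarrow> real) \<Rightarrow> bool" where
  "hoelder_continuous \<beta> g \<longleftrightarrow> (\<exists>L. \<forall>x y. \<bar>g x - g y\<bar> \<le> L * \<bar>x - y\<bar> powr \<beta>)"

end

theory Submission
  imports Defs
begin

text \<open>
  Once every cell contains a point just above the graph and none lies below it, the likelihood
  factorizes over the cells, and the posterior is the product of the densities proportional to
  \<open>q\<^sub>j g\<close>, where \<open>q\<^sub>j\<close> is the \<open>j\<close>-th reflected exponential density, of rate
  \<open>l\<^sub>j = n (t\<^sub>j - t\<^sub>j\<^sub>-\<^sub>1)\<close>, whose product is the limit distribution. Since \<open>q\<^sub>j\<close>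
  lives on the scale \<open>1 / l\<^sub>j\<close>, tilting it by the \<open>\<beta>\<close>-Hoelder function \<open>g\<close>, which is
  bounded away from \<open>0\<close> near the data, costs \<open>O(l\<^sub>j powr - \<beta>)\<close> in \<open>L\<^sup>1\<close>. The total
  variation distance of products is at most the sum over the factors, so with
  \<open>m = min\<^sub>j l\<^sub>j\<close> it is \<open>O(K * m powr - \<beta>)\<close>. By the void probabilities of the Poisson
  process the exceptional event has probability at most \<open>K * exp (- m)\<close>, which is of smaller order.
\<close>

subsection \<open>Product measures and total variation\<close>

text \<open>A measure on a finite product is determined by its values on boxes. Only the factors
  with index in \<open>I\<close> have to be sigma-finite: the auxiliary family \<open>M'\<close>
  puts a point mass at every other index, which leaves the product unchanged. The exponential laws
  used later are known to be probability measures only for indices in \<open>{1..K}\<close>.\<close>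

lemma PiM_eqI_finite:
  assumes "finite I" and "\<And>i. i \<in> I \<Longrightarrow> sigma_finite_measure (M i)" and "sets P = sets (Pi\<^sub>M I M)"
    and eq: "\<And>A. (\<And>i. i \<in> I \<Longrightarrow> A i \<in> sets (M i)) \<Longrightarrow>
      emeasure P (Pi\<^sub>E I A) = (\<Prod>i\<in>I. emeasure (M i) (A i))"
  shows "P = Pi\<^sub>M I M"
proof -
  define M' where "M' i = (if i \<in> I then M i else return (count_space UNIV) undefined)" for i
  interpret product_sigma_finite M'
  proof (rule product_sigma_finite.intro)
    show "sigma_finite_measure (M' i)" for i
      using assms(2) by (simp add: M'_def prob_space_imp_sigma_finite prob_space_return)
  qed
  have M': "Pi\<^sub>M I M = Pi\<^sub>M I M'"
    by (rule PiM_cong) (auto simp: M'_def)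
  have "P = Pi\<^sub>M I M'"
    by (rule PiM_eqI) (use assms M' in \<open>auto simp: M'_def cong: prod.cong\<close>)
  then show ?thesis
    using M' by simp
qed

text \<open>Both measures agree on boxes: there the indicator factorizes along with the density, and
  the integral of a product of functions of single coordinates is the product of their
  integrals.\<close>

lemma density_PiM:
  fixes f :: "'i \<Rightarrow> 'a \<Rightarrow> ennreal"
  assumes "product_sigma_finite M" and I: "finite I"
    and f: "\<And>i. i \<in> I \<Longrightarrow> f i \<in> borel_measurable (M i)"
    and prob: "\<And>i. i \<in> I \<Longrightarrow> prob_space (density (M i) (f i))"
  shows "density (Pi\<^sub>M I M) (\<lambda>x. \<Prod>i\<in>I. f i (x i)) = Pi\<^sub>M I (\<lambda>i. density (M i) (f i))"
proof (rule PiM_eqI_finite[OF I])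
  interpret product_sigma_finite M by fact
  note f[measurable]
  fix A assume A: "\<And>i. i \<in> I \<Longrightarrow> A i \<in> sets (density (M i) (f i))"
  have [measurable]: "Pi\<^sub>E I A \<in> sets (Pi\<^sub>M I M)"
    using A I by (intro sets_PiM_I_finite) auto
  \<comment> \<open>Points of the product space are extensional, so a point outside the box violates
    one of its coordinate conditions, and the corresponding factor on the right is 0.\<close>
  have *: "(\<Prod>i\<in>I. f i (x i)) * indicator (Pi\<^sub>E I A) x = (\<Prod>i\<in>I. f i (x i) * indicator (A i) (x i))"
    if "x \<in> space (Pi\<^sub>M I M)" for x
  proof (cases "x \<in> Pi\<^sub>E I A")
    case True
    then show ?thesis by (auto intro!: prod.cong simp: PiE_def Pi_def)
  next
    case False
    moreover have "x \<in> extensional I"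
      using that by (simp add: space_PiM PiE_def)
    ultimately obtain i where "i \<in> I" "x i \<notin> A i"
      by (auto simp: PiE_def Pi_def)
    then have "(\<Prod>i\<in>I. f i (x i) * indicator (A i) (x i)) = 0"
      using I \<open>i \<in> I\<close> \<open>x i \<notin> A i\<close> by (intro prod_zero bexI[of _ i]) simp_all
    then show ?thesis
      using False by simp
  qed
  have "emeasure (density (Pi\<^sub>M I M) (\<lambda>x. \<Prod>i\<in>I. f i (x i))) (Pi\<^sub>E I A) =
      (\<integral>\<^sup>+x. (\<Prod>i\<in>I. f i (x i)) * indicator (Pi\<^sub>E I A) x \<partial>Pi\<^sub>M I M)"
    by (rule emeasure_density) (use I in measurable)
  also have "\<dots> = (\<integral>\<^sup>+x. (\<Prod>i\<in>I. f i (x i) * indicator (A i) (x i)) \<partial>Pi\<^sub>M I M)"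
    by (rule nn_integral_cong) (rule *)
  also have "\<dots> = (\<Prod>i\<in>I. \<integral>\<^sup>+x. f i x * indicator (A i) x \<partial>M i)"
    using A by (intro product_nn_integral_prod I) (auto intro!: borel_measurable_times_ennreal f borel_measurable_indicator)
  also have "\<dots> = (\<Prod>i\<in>I. emeasure (density (M i) (f i)) (A i))"
    using A f by (auto intro!: prod.cong simp: emeasure_density)
  finally show "emeasure (density (Pi\<^sub>M I M) (\<lambda>x. \<Prod>i\<in>I. f i (x i))) (Pi\<^sub>E I A) =
      (\<Prod>i\<in>I. emeasure (density (M i) (f i)) (A i))" .
qed (auto intro: prob_space_imp_sigma_finite prob intro!: sets_PiM_cong)

text \<open>The preimage of a box under a map acting coordinatewise is again a box, so both measures
  give the same product on boxes.\<close>

lemma distr_PiM_components: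
  assumes I: "finite I" and prob: "\<And>i. i \<in> I \<Longrightarrow> prob_space (M i)"
    and h: "\<And>i. i \<in> I \<Longrightarrow> h i \<in> M i \<rightarrow>\<^sub>M N i"
  shows "distr (Pi\<^sub>M I M) (Pi\<^sub>M I N) (\<lambda>x. \<lambda>i\<in>I. h i (x i)) = Pi\<^sub>M I (\<lambda>i. distr (M i) (N i) (h i))"
proof (rule PiM_eqI_finite[OF I])
  define M' where "M' i = (if i \<in> I then M i else return (count_space UNIV) undefined)" for i
  interpret product_sigma_finite M'
  proof (rule product_sigma_finite.intro)
    show "sigma_finite_measure (M' i)" for i
      using prob by (simp add: M'_def prob_space_imp_sigma_finite prob_space_return)
  qed
  have M': "Pi\<^sub>M I M = Pi\<^sub>M I M'"
    by (rule PiM_cong) (auto simp: M'_def)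
  note h[measurable]
  fix A assume A: "\<And>i. i \<in> I \<Longrightarrow> A i \<in> sets (distr (M i) (N i) (h i))"
  have [measurable]: "Pi\<^sub>E I A \<in> sets (Pi\<^sub>M I N)"
    using A I by (intro sets_PiM_I_finite) auto
  have m: "(\<lambda>x. \<lambda>i\<in>I. h i (x i)) \<in> Pi\<^sub>M I M \<rightarrow>\<^sub>M Pi\<^sub>M I N"
    by (rule measurable_restrict) measurable
  have "(\<lambda>x. \<lambda>i\<in>I. h i (x i)) -` Pi\<^sub>E I A \<inter> space (Pi\<^sub>M I M) = Pi\<^sub>E I (\<lambda>i. h i -` A i \<inter> space (M i))"
    by (auto simp: space_PiM PiE_def Pi_def)
  then have "emeasure (distr (Pi\<^sub>M I M) (Pi\<^sub>M I N) (\<lambda>x. \<lambda>i\<in>I. h i (x i))) (Pi\<^sub>E I A) =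
      emeasure (Pi\<^sub>M I M') (Pi\<^sub>E I (\<lambda>i. h i -` A i \<inter> space (M i)))"
    by (subst emeasure_distr[OF m]) (auto simp: M')
  also have "\<dots> = (\<Prod>i\<in>I. emeasure (M' i) (h i -` A i \<inter> space (M i)))"
    using A h by (intro emeasure_PiM I) (auto simp: M'_def intro: measurable_sets)
  also have "\<dots> = (\<Prod>i\<in>I. emeasure (distr (M i) (N i) (h i)) (A i))"
    using A h by (auto intro!: prod.cong simp: M'_def emeasure_distr)
  finally show "emeasure (distr (Pi\<^sub>M I M) (Pi\<^sub>M I N) (\<lambda>x. \<lambda>i\<in>I. h i (x i))) (Pi\<^sub>E I A) =
      (\<Prod>i\<in>I. emeasure (distr (M i) (N i) (h i)) (A i))" .
qed (auto intro!: prob_space_imp_sigma_finite prob_space.prob_space_distr prob h sets_PiM_cong)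

text \<open>Telescoping: the factors of one product are exchanged for those of the other one at a
  time, and the induction splits off the last index. Each summand is kept as a single product over
  all indices so that its integral under a product measure factorizes.\<close>

lemma abs_prod_diff_le:
  fixes p q :: "nat \<Rightarrow> real"
  assumes "\<And>j. j \<in> {1..K} \<Longrightarrow> 0 \<le> p j" "\<And>j. j \<in> {1..K} \<Longrightarrow> 0 \<le> q j"
  shows "\<bar>(\<Prod>j=1..K. p j) - (\<Prod>j=1..K. q j)\<bar> \<le>
    (\<Sum>i=1..K. \<Prod>j=1..K. if j < i then p j else if j = i then \<bar>p j - q j\<bar> else q j)"
  using assms
proof (induction K)
  case (Suc K)
  let ?h = "\<lambda>i j. if j < i then p j else if j = i then \<bar>p j - q j\<bar> else q j"
  have nn: "0 \<le> (\<Prod>j=1..K. p j)" "0 \<le> q (Suc K)"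
    using Suc.prems by (auto intro!: prod_nonneg)
  have 1: "(\<Prod>j=1..Suc K. ?h (Suc K) j) = (\<Prod>j=1..K. p j) * \<bar>p (Suc K) - q (Suc K)\<bar>"
    by (subst prod.nat_ivl_Suc') (auto simp: mult.commute intro!: arg_cong2[where f="(*)"] prod.cong)
  have 2: "(\<Prod>j=1..Suc K. ?h i j) = (\<Prod>j=1..K. ?h i j) * q (Suc K)" if "i \<in> {1..K}" for i
    using that by (subst prod.nat_ivl_Suc') (simp_all add: mult.commute)
  have "\<bar>(\<Prod>j=1..Suc K. p j) - (\<Prod>j=1..Suc K. q j)\<bar> =
      \<bar>(\<Prod>j=1..K. p j) * (p (Suc K) - q (Suc K)) + ((\<Prod>j=1..K. p j) - (\<Prod>j=1..K. q j)) * q (Suc K)\<bar>"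
    by (simp add: algebra_simps)
  also have "\<dots> \<le> (\<Prod>j=1..K. p j) * \<bar>p (Suc K) - q (Suc K)\<bar> +
      \<bar>(\<Prod>j=1..K. p j) - (\<Prod>j=1..K. q j)\<bar> * q (Suc K)"
    using nn by (intro order.trans[OF abs_triangle_ineq]) (simp add: abs_mult)
  also have "\<dots> \<le> (\<Prod>j=1..K. p j) * \<bar>p (Suc K) - q (Suc K)\<bar> +
      (\<Sum>i=1..K. \<Prod>j=1..K. ?h i j) * q (Suc K)"
    using Suc nn by (intro add_left_mono mult_right_mono Suc.IH) auto
  also have "\<dots> = (\<Sum>i=1..Suc K. \<Prod>j=1..Suc K. ?h i j)"
  proof -
    have "(\<Sum>i=1..Suc K. \<Prod>j=1..Suc K. ?h i j) =
        (\<Prod>j=1..Suc K. ?h (Suc K) j) + (\<Sum>i=1..K. \<Prod>j=1..Suc K. ?h i j)"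
      by (rule sum.nat_ivl_Suc') simp
    also have "(\<Sum>i=1..K. \<Prod>j=1..Suc K. ?h i j) = (\<Sum>i=1..K. \<Prod>j=1..K. ?h i j) * q (Suc K)"
      unfolding sum_distrib_right by (rule sum.cong[OF refl 2])
    finally show ?thesis
      using 1 by simp
  qed
  finally show ?case .
qed simp

text \<open>In the \<open>i\<close>-th telescoping summand every factor except the
  \<open>i\<close>-th is a probability density and integrates to 1, which leaves the distance of the
  \<open>i\<close>-th marginals.\<close>

lemma integral_abs_prod_diff_le:
  fixes p q :: "nat \<Rightarrow> real \<Rightarrow> real"
  assumes p: "\<And>j. j \<in> {1..K} \<Longrightarrow> integrable lborel (p j)" "\<And>j x. j \<in> {1..K} \<Longrightarrow> 0 \<le> p j x"
      "\<And>j. j \<in> {1..K} \<Longrightarrow> integral\<^sup>L lborel (p j) = 1"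
    and q: "\<And>j. j \<in> {1..K} \<Longrightarrow> integrable lborel (q j)" "\<And>j x. j \<in> {1..K} \<Longrightarrow> 0 \<le> q j x"
      "\<And>j. j \<in> {1..K} \<Longrightarrow> integral\<^sup>L lborel (q j) = 1"
  shows "(\<integral>a. \<bar>(\<Prod>j=1..K. p j (a j)) - (\<Prod>j=1..K. q j (a j))\<bar> \<partial>lebesgue_prod K) \<le>
    (\<Sum>j=1..K. \<integral>x. \<bar>p j x - q j x\<bar> \<partial>lborel)"
proof -
  interpret product_sigma_finite "\<lambda>_::nat. lborel :: real measure" ..
  define h where "h i j x = (if j < i then p j x else if j = i then \<bar>p j x - q j x\<bar> else q j x)" for i j x
  have h: "integrable lborel (h i j)" if "j \<in> {1..K}" for i j
    using p(1)[OF that] q(1)[OF that] unfolding h_def by (cases i j rule: linorder_cases) auto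
  have int: "integrable (lebesgue_prod K) (\<lambda>a. \<Prod>j=1..K. h i j (a j))" for i
    using h by (intro product_integrable_prod) auto
  have "(\<integral>a. \<bar>(\<Prod>j=1..K. p j (a j)) - (\<Prod>j=1..K. q j (a j))\<bar> \<partial>lebesgue_prod K) \<le>
      (\<integral>a. (\<Sum>i=1..K. \<Prod>j=1..K. h i j (a j)) \<partial>lebesgue_prod K)"
  proof (intro integral_mono)
    show "integrable (lebesgue_prod K) (\<lambda>a. \<bar>(\<Prod>j=1..K. p j (a j)) - (\<Prod>j=1..K. q j (a j))\<bar>)"
      using p q by (intro integrable_abs Bochner_Integration.integrable_diff product_integrable_prod) auto
    show "\<bar>(\<Prod>j=1..K. p j (a j)) - (\<Prod>j=1..K. q j (a j))\<bar> \<le> (\<Sum>i=1..K. \<Prod>j=1..K. h i j (a j))" for a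
      unfolding h_def using p(2) q(2) by (intro abs_prod_diff_le) auto
  qed (use int in auto)
  also have "\<dots> = (\<Sum>i=1..K. \<Prod>j=1..K. integral\<^sup>L lborel (h i j))"
    using int h by (subst Bochner_Integration.integral_sum) (auto intro!: sum.cong product_integral_prod)
  also have "\<dots> = (\<Sum>i=1..K. \<integral>x. \<bar>p i x - q i x\<bar> \<partial>lborel)"
  proof (rule sum.cong[OF refl])
    fix i assume i: "i \<in> {1..K}"
    have "h i j = (if j < i then p j else if j = i then \<lambda>x. \<bar>p j x - q j x\<bar> else q j)" for j
      by (auto simp: h_def fun_eq_iff)
    then have "(\<Prod>j=1..K. integral\<^sup>L lborel (h i j)) =
        (\<Prod>j=1..K. if j = i then \<integral>x. \<bar>p i x - q i x\<bar> \<partial>lborel else 1)"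
      using p(3) q(3) by (intro prod.cong) auto
    also have "\<dots> = (\<integral>x. \<bar>p i x - q i x\<bar> \<partial>lborel)"
      using i by simp
    finally show "(\<Prod>j=1..K. integral\<^sup>L lborel (h i j)) = (\<integral>x. \<bar>p i x - q i x\<bar> \<partial>lborel)" .
  qed
  finally show ?thesis .
qed

text \<open>The difference of the two measures on \<open>B\<close> is the integral of
  \<open>p - q\<close> over \<open>B\<close>. For probability densities the sharp bound has a
  further factor 1/2, which would only change constants later on.\<close>

lemma tv_norm_density_le:
  fixes p q :: "'a \<Rightarrow> real"
  assumes p: "integrable M p" "\<And>x. 0 \<le> p x" and q: "integrable M q" "\<And>x. 0 \<le> q x"
  shows "tv_norm (density M p) (density M q) \<le> (\<integral>x. \<bar>p x - q x\<bar> \<partial>M)"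
  unfolding tv_norm_def
proof (rule cSUP_least)
  fix B assume "B \<in> sets (density M p)"
  then have B: "B \<in> sets M" by simp
  have *: "measure (density M f) B = (\<integral>x. indicator B x * f x \<partial>M)"
    if "integrable M f" "\<And>x. 0 \<le> f x" for f :: "'a \<Rightarrow> real"
  proof -
    have "measure (density M f) B = enn2real (\<integral>\<^sup>+x. ennreal (indicator B x * f x) \<partial>M)"
      using that B
      by (auto simp: measure_def emeasure_density indicator_def intro!: arg_cong[where f=enn2real] nn_integral_cong)
    also have "\<dots> = (\<integral>x. indicator B x * f x \<partial>M)"
      using that B by (intro integral_eq_nn_integral[symmetric]) auto
    finally show ?thesis .
  qed
  have "\<bar>measure (density M p) B - measure (density M q) B\<bar> = \<bar>\<integral>x. indicator B x * (p x - q x) \<partial>M\<bar>"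
    using B p q by (simp add: * right_diff_distrib integrable_real_mult_indicator mult.commute)
  also have "\<dots> \<le> (\<integral>x. \<bar>indicator B x * (p x - q x)\<bar> \<partial>M)"
    by (rule integral_abs_bound)
  also have "\<dots> \<le> (\<integral>x. \<bar>p x - q x\<bar> \<partial>M)"
  proof (intro integral_mono integrable_abs)
    show "integrable M (\<lambda>x. indicator B x * (p x - q x))"
      unfolding mult.commute[of "indicator B _"] using B p q
      by (intro integrable_real_mult_indicator Bochner_Integration.integrable_diff)
  qed (use p q in \<open>auto simp: indicator_def\<close>)
  finally show "\<bar>measure (density M p) B - measure (density M q) B\<bar> \<le> (\<integral>x. \<bar>p x - q x\<bar> \<partial>M)" .
qed auto

lemma tv_norm_le_1:
  assumes "\<And>B. B \<in> sets P \<Longrightarrow> measure P B \<le> 1" "\<And>B. B \<in> sets P \<Longrightarrow> measure Q B \<le> 1"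
  shows "tv_norm P Q \<le> 1"
  unfolding tv_norm_def
proof (rule cSUP_least)
  fix B assume "B \<in> sets P"
  then show "\<bar>measure P B - measure Q B\<bar> \<le> 1"
    using assms[of B] measure_nonneg[of P B] measure_nonneg[of Q B] by linarith
qed auto

subsection \<open>Tilted exponential densities\<close>

text \<open>These are the mass and the mean distance from \<open>A\<close> of the law of
  \<open>A - \<eta>\<close> with \<open>\<eta>\<close> exponential of rate \<open>l\<close>. They
  come from the Erlang moments of order 0 and 1 through the reflection
  \<open>x = A - a\<close>.\<close>

lemma
  fixes l A :: real
  assumes "0 < l"
  shows integrable_reflected_exponential: "integrable lborel (\<lambda>a. exponential_density l (A - a))"
    and integral_reflected_exponential: "(\<integral>a. exponential_density l (A - a) \<partial>lborel) = 1"
    and integrable_reflected_exponential_moment: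
      "integrable lborel (\<lambda>a. exponential_density l (A - a) * (A - a))"
    and integral_reflected_exponential_moment:
      "(\<integral>a. exponential_density l (A - a) * (A - a) \<partial>lborel) = 1 / l"
proof -
  have nn: "0 \<le> exponential_density l x" "0 \<le> exponential_density l x * x" for x
    using assms by (simp_all add: exponential_density_def)
  have "(\<integral>\<^sup>+x. ennreal (exponential_density l x * x ^ i) \<partial>lborel) = ennreal (fact i / l ^ i)" for i
    using nn_integral_erlang_ith_moment[OF assms, of 0 i] by simp
  from this[of 0] this[of 1]
  have "has_bochner_integral lborel (exponential_density l) 1"
    "has_bochner_integral lborel (\<lambda>x. exponential_density l x * x) (1 / l)"
    using assms nn by (auto intro!: has_bochner_integral_nn_integral)
  then have i: "integrable lborel (exponential_density l)"
      "integrable lborel (\<lambda>x. exponential_density l x * x)"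
    and e: "(\<integral>x. exponential_density l x \<partial>lborel) = 1"
      "(\<integral>x. exponential_density l x * x \<partial>lborel) = 1 / l"
    by (auto simp: has_bochner_integral_iff)
  show "integrable lborel (\<lambda>a. exponential_density l (A - a))"
    "integrable lborel (\<lambda>a. exponential_density l (A - a) * (A - a))"
    using i[THEN lborel_integrable_real_affine[where c = "-1" and t = A]] by simp_all
  show "(\<integral>a. exponential_density l (A - a) \<partial>lborel) = 1"
    "(\<integral>a. exponential_density l (A - a) * (A - a) \<partial>lborel) = 1 / l"
    using e lborel_integral_real_affine[of "-1" "exponential_density l" A]
      lborel_integral_real_affine[of "-1" "\<lambda>x. exponential_density l x * x" A] by simp_all
qed

text \<open>This controls a fractional moment by the moments of order 0 and 1, so that Gamma
  functions do not enter.\<close>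

lemma powr_le_1_plus:
  fixes x :: real
  assumes "0 \<le> x" "0 < b" "b \<le> 1"
  shows "x powr b \<le> 1 + x"
proof (cases "x \<le> 1")
  case True
  then have "x powr b \<le> 1 powr b" using assms by (intro powr_mono2) auto
  then show ?thesis using assms by simp
next
  case False
  then have "x powr b \<le> x powr 1" using assms by (intro powr_mono) auto
  then show ?thesis using False by simp
qed

text \<open>
  At scale \<open>1 / l\<close> Hoelder continuity makes \<open>g\<close> almost constant, so reweighting the reflected
  exponential density by \<open>g\<close> hardly changes it.
\<close>

lemma exponential_tilt:
  fixes g :: "real \<Rightarrow> real"
  assumes l: "0 < l" and g: "integrable lborel g" "\<And>x. 0 \<le> g x"
    and \<beta>: "0 < \<beta>" "\<beta> \<le> 1" and L: "0 \<le> L" "\<And>x. \<bar>g x - g A\<bar> \<le> L * \<bar>x - A\<bar> powr \<beta>"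
  defines "q \<equiv> \<lambda>a. exponential_density l (A - a)"
    and "e \<equiv> 2 * L * l powr - \<beta>"
  defines "Z \<equiv> \<integral>a. q a * g a \<partial>lborel"
  shows "integrable lborel (\<lambda>a. q a * g a)" and "\<bar>Z - g A\<bar> \<le> e"
    and "0 < Z \<Longrightarrow> (\<integral>a. \<bar>q a * g a / Z - q a\<bar> \<partial>lborel) \<le> 2 * e / Z"
proof -
  define h where "h a = q a * (g a - g A)" for a
  \<comment> \<open>\<open>B\<close> is an integrable majorant of \<open>h\<close>. Below
    \<open>A\<close>, rescaling by \<open>l\<close> turns the Hoelder bound into
    \<open>L * l powr - \<beta> * (l * (A - a)) powr \<beta>\<close>, and the fractional power is at
    most \<open>1 + l * (A - a)\<close>. Above \<open>A\<close> the density \<open>q\<close>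
    vanishes. The two terms of \<open>B\<close> have equal integrals, whence the factor 2 in
    \<open>e\<close>.\<close>
  define B where "B a = L * l powr - \<beta> * (q a + l * (q a * (A - a)))" for a
  have q: "0 \<le> q a" "q a \<le> l" for a
    using l by (auto simp: q_def exponential_density_def intro!: mult_nonpos_nonneg)
  have qi: "integrable lborel q" "integral\<^sup>L lborel q = 1"
    "integrable lborel (\<lambda>a. q a * (A - a))" "(\<integral>a. q a * (A - a) \<partial>lborel) = 1 / l"
    unfolding q_def using l by (auto intro: integrable_reflected_exponential integral_reflected_exponential
      integrable_reflected_exponential_moment integral_reflected_exponential_moment)
  note [measurable] = borel_measurable_integrable[OF g(1)] borel_measurable_integrable[OF qi(1)]
  show qg: "integrable lborel (\<lambda>a. q a * g a)"
    by (rule Bochner_Integration.integrable_bound[of _ "\<lambda>a. l * g a"])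
      (use g q l in \<open>auto simp: abs_mult intro!: mult_right_mono\<close>)
  have hi: "integrable lborel h"
    unfolding h_def right_diff_distrib using qg qi by auto
  have hB: "\<bar>h a\<bar> \<le> B a" for a
  proof (cases "a \<le> A")
    case True
    have lA: "0 \<le> l * (A - a)" using l True by (intro mult_nonneg_nonneg) auto
    have "\<bar>a - A\<bar> powr \<beta> = l powr - \<beta> * (l * (A - a)) powr \<beta>"
    proof -
      have "(l * (A - a)) powr \<beta> = l powr \<beta> * (A - a) powr \<beta>"
        by (rule powr_mult)
      then show ?thesis
        using l True by (simp add: powr_minus)
    qed
    also have "\<dots> \<le> l powr - \<beta> * (1 + l * (A - a))"
      using lA \<beta> by (intro mult_left_mono powr_le_1_plus) auto
    finally have "\<bar>g a - g A\<bar> \<le> L * (l powr - \<beta> * (1 + l * (A - a)))"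
      by (rule order.trans[OF L(2) mult_left_mono[OF _ L(1)]])
    then have "q a * \<bar>g a - g A\<bar> \<le> q a * (L * (l powr - \<beta> * (1 + l * (A - a))))"
      using q by (intro mult_left_mono)
    moreover have "\<bar>h a\<bar> = q a * \<bar>g a - g A\<bar>"
      using q by (simp add: h_def abs_mult)
    ultimately show ?thesis
      by (simp add: B_def algebra_simps)
  next
    case False
    then show ?thesis by (simp add: h_def B_def q_def exponential_density_def)
  qed
  have Bi: "integrable lborel B"
    unfolding B_def using qi by auto
  have "integral\<^sup>L lborel B = L * l powr - \<beta> * (1 + l * (1 / l))"
    unfolding B_def using qi by (subst integral_mult_right_zero, subst Bochner_Integration.integral_add) auto
  also have "\<dots> = e"
    using l by (simp add: e_def)
  finally have he: "(\<integral>a. \<bar>h a\<bar> \<partial>lborel) \<le> e"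
    using hi Bi hB integral_mono[of lborel "\<lambda>a. \<bar>h a\<bar>" B] by auto
  have "Z - g A = integral\<^sup>L lborel h"
    unfolding h_def right_diff_distrib Z_def using qg qi by simp
  also have "\<bar>\<dots>\<bar> \<le> e"
    using integral_abs_bound[of lborel h] he by linarith
  finally show ZgA: "\<bar>Z - g A\<bar> \<le> e" .
  assume Z: "0 < Z"
  \<comment> \<open>Both \<open>g a\<close> and the normalization \<open>Z\<close> are compared with
    the constant \<open>g A\<close>. Each of the two errors contributes at most \<open>e / Z\<close>
    to the integral.\<close>
  have "(\<integral>a. \<bar>q a * g a / Z - q a\<bar> \<partial>lborel) \<le> (\<integral>a. (\<bar>h a\<bar> + e * q a) / Z \<partial>lborel)"
  proof (rule integral_mono)
    show "\<bar>q a * g a / Z - q a\<bar> \<le> (\<bar>h a\<bar> + e * q a) / Z" for a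
    proof -
      have "\<bar>q a * g a / Z - q a\<bar> = \<bar>h a - (Z - g A) * q a\<bar> / Z"
      proof -
        have "q a * g a / Z - q a = (h a - (Z - g A) * q a) / Z"
          using Z by (simp add: h_def field_simps)
        then show ?thesis using Z by (simp add: abs_divide)
      qed
      also have "\<dots> \<le> (\<bar>h a\<bar> + e * q a) / Z"
      proof (rule divide_right_mono)
        have "\<bar>(Z - g A) * q a\<bar> \<le> e * q a"
          using ZgA q by (simp add: abs_mult mult_right_mono)
        then show "\<bar>h a - (Z - g A) * q a\<bar> \<le> \<bar>h a\<bar> + e * q a"
          by linarith
      qed (use Z in simp)
      finally show ?thesis .
    qed
  qed (use qg qi hi in auto)
  also have "\<dots> = ((\<integral>a. \<bar>h a\<bar> \<partial>lborel) + e) / Z"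
    using hi qi by simp
  also have "\<dots> \<le> 2 * e / Z"
    using he Z by (intro divide_right_mono) auto
  finally show "(\<integral>a. \<bar>q a * g a / Z - q a\<bar> \<partial>lborel) \<le> 2 * e / Z" .
qed

subsection \<open>Hoelder continuity and the mesh condition\<close>

lemma hoelder_continuous_imp_continuous_on:
  assumes "hoelder_continuous \<beta> g" "0 < \<beta>"
  shows "continuous_on S g"
proof -
  obtain L where L: "\<And>x y. \<bar>g x - g y\<bar> \<le> L * \<bar>x - y\<bar> powr \<beta>"
    using assms(1) by (auto simp: hoelder_continuous_def)
  have "isCont g x" for x
  proof -
    have "((\<lambda>y. \<bar>y - x\<bar>) \<longlongrightarrow> 0) (at x)"
      by (intro tendsto_rabs_zero LIM_zero tendsto_ident_at)
    then have "((\<lambda>y. L * \<bar>y - x\<bar> powr \<beta>) \<longlongrightarrow> 0) (at x)"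
      using assms(2) by (intro tendsto_mult_right_zero tendsto_zero_powrI[where b = \<beta>]) auto
    then have "((\<lambda>y. g y - g x) \<longlongrightarrow> 0) (at x)"
      by (rule Lim_null_comparison[rotated]) (use L in simp)
    then show ?thesis
      by (simp add: isCont_def LIM_zero_cancel)
  qed
  then show ?thesis
    by (intro continuous_at_imp_continuous_on) auto
qed

lemma mesh_condition_tendsto:
  fixes K :: "nat \<Rightarrow> nat" and m :: "nat \<Rightarrow> real"
  assumes \<beta>: "0 < \<beta>" and K: "\<And>n. 0 < K n" and m: "\<And>n. 0 \<le> m n"
    and m_1: "\<And>n. K n = 1 \<Longrightarrow> m n = real n"
    and lim: "(\<lambda>n. ennreal (m n) / ennreal (real (K n) powr (1 / \<beta>) * ln (real (K n)))) \<longlonglongrightarrow> \<infinity>"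
  shows "eventually (\<lambda>n. C \<le> m n) sequentially" and "(\<lambda>n. real (K n) * m n powr - \<beta>) \<longlonglongrightarrow> 0"
proof -
  have key: "eventually (\<lambda>n. M * real (K n) powr (1 / \<beta>) \<le> m n) sequentially" if M: "0 < M" for M
  proof -
    \<comment> \<open>The divisor \<open>ln 2\<close> is made up for by the lower bound on the
      logarithm.\<close>
    have "eventually (\<lambda>n. ennreal (M / ln 2) < ennreal (m n) / ennreal (real (K n) powr (1 / \<beta>) * ln (real (K n)))) sequentially"
      using lim by (rule order_tendstoD) simp
    moreover have "eventually (\<lambda>n. M \<le> real n) sequentially"
      using filterlim_real_sequentially by (auto simp: filterlim_at_top)
    ultimately show ?thesis
    proof eventually_elim
      case (elim n)
      show ?case
      proof (cases "K n = 1")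
        case True
        then show ?thesis using elim m_1 by simp
      next
        case False
        then have K2: "2 \<le> real (K n)" using K[of n] by linarith
        define r where "r = real (K n) powr (1 / \<beta>)"
        have r: "0 < r" using K2 by (simp add: r_def)
        have ln: "0 < ln (real (K n))" "ln 2 \<le> ln (real (K n))" using K2 by auto
        have "ennreal (M / ln 2) < ennreal (m n / (r * ln (real (K n))))"
          using elim(1) r ln m[of n] by (simp add: divide_ennreal r_def)
        then have "M / ln 2 < m n / (r * ln (real (K n)))"
          using M by (subst (asm) ennreal_less_iff) auto
        then have "M / ln 2 * (r * ln (real (K n))) < m n"
          using r ln by (simp add: pos_less_divide_eq)
        moreover have "M / ln 2 * (r * ln 2) \<le> M / ln 2 * (r * ln (real (K n)))"
          using M r ln by (intro mult_left_mono) auto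
        ultimately show ?thesis by (simp add: r_def)
      qed
    qed
  qed
  have K1: "1 \<le> real (K n) powr (1 / \<beta>)" for n
    using K[of n] \<beta> by (intro ge_one_powr_ge_zero) auto
  show "eventually (\<lambda>n. C \<le> m n) sequentially"
  proof -
    \<comment> \<open>The maximum with 1 provides the positive factor that \<open>key\<close> asks
      for.\<close>
    have "eventually (\<lambda>n. max C 1 * real (K n) powr (1 / \<beta>) \<le> m n) sequentially"
      by (rule key) simp
    then show ?thesis
    proof eventually_elim
      case (elim n)
      have "max C 1 * 1 \<le> max C 1 * real (K n) powr (1 / \<beta>)"
        using K1 by (intro mult_left_mono) auto
      then show ?case using elim by simp
    qed
  qed
  show "(\<lambda>n. real (K n) * m n powr - \<beta>) \<longlonglongrightarrow> 0"
  proof (rule order_tendstoI)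
    fix e :: real assume e: "0 < e"
    \<comment> \<open>The choice solves \<open>M powr - \<beta> = e / 2\<close>; the half leaves
      room for the strict inequality.\<close>
    define M where "M = (e / 2) powr (- 1 / \<beta>)"
    have M: "0 < M" using e by (simp add: M_def)
    show "eventually (\<lambda>n. real (K n) * m n powr - \<beta> < e) sequentially"
      using key[OF M]
    proof eventually_elim
      case (elim n)
      have "m n powr - \<beta> \<le> (M * real (K n) powr (1 / \<beta>)) powr - \<beta>"
        using M K[of n] elim \<beta> by (intro powr_mono2') auto
      also have "\<dots> = M powr - \<beta> * (real (K n) powr (1 / \<beta>)) powr - \<beta>"
        by (rule powr_mult)
      also have "\<dots> = e / 2 / real (K n)"
      proof -
        have *: "M powr - \<beta> = (e / 2) powr 1" "(real (K n) powr (1 / \<beta>)) powr - \<beta> = real (K n) powr - 1"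
          using \<beta> by (simp_all only: M_def powr_powr) simp_all
        show ?thesis
          unfolding * using e K[of n] by (simp add: powr_minus_divide)
      qed
      finally have "real (K n) * m n powr - \<beta> \<le> real (K n) * (e / 2 / real (K n))"
        by (intro mult_left_mono) auto
      then show ?case using K[of n] e by simp
    qed
  next
    fix e :: real assume "e < 0"
    then show "eventually (\<lambda>n. e < real (K n) * m n powr - \<beta>) sequentially"
      by (intro always_eventually allI) (rule less_le_trans, auto)
  qed
qed

subsection \<open>Void probabilities\<close>

text \<open>A void is the event that the Poisson count is 0, so this is the case
  \<open>k = 0\<close> of the Poisson weights.\<close>

lemma poisson_void_probability:
  assumes ppp: "poisson_point_process M Z \<Lambda>" and A: "A \<in> sets \<Lambda>" "emeasure \<Lambda> A < \<infinity>"
  shows "{\<omega>\<in>space M. \<forall>i. Z i \<omega> \<notin> A} \<in> sets M"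
    and "emeasure M {\<omega>\<in>space M. \<forall>i. Z i \<omega> \<notin> A} = ennreal (exp (- measure \<Lambda> A))"
proof -
  interpret prob_space M using ppp by (simp add: poisson_point_process_def)
  have [measurable]: "Z i \<in> M \<rightarrow>\<^sub>M \<Lambda>" for i
    using ppp by (simp add: poisson_point_process_def)
  note A(1)[measurable]
  show "{\<omega>\<in>space M. \<forall>i. Z i \<omega> \<notin> A} \<in> sets M"
    by measurable
  have "count_points (\<lambda>i. Z i \<omega>) A = of_nat 0 \<longleftrightarrow> (\<forall>i. Z i \<omega> \<notin> A)" for \<omega>
    by (simp add: count_points_def emeasure_count_space_eq_0)
  moreover have "measure M {\<omega>\<in>space M. count_points (\<lambda>i. Z i \<omega>) A = of_nat 0} =
      measure \<Lambda> A ^ 0 / fact 0 * exp (- measure \<Lambda> A)"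
    using ppp A unfolding poisson_point_process_def by blast
  ultimately show "emeasure M {\<omega>\<in>space M. \<forall>i. Z i \<omega> \<notin> A} = ennreal (exp (- measure \<Lambda> A))"
    by (simp add: emeasure_eq_measure)
qed

lemma space_boundary_intensity: "space (boundary_intensity n f) = {0..1} \<times> UNIV"
  by (simp add: boundary_intensity_def space_restrict_space)

text \<open>Inside the strip the restriction of the base measure has no effect, and the density is
  \<open>n\<close> times the indicator of the epigraph. Intensities thus reduce to planar
  areas.\<close>

lemma
  assumes f[measurable]: "f \<in> borel_measurable borel" and A[measurable]: "A \<in> sets borel"
    and "A \<subseteq> {0..1} \<times> UNIV"
  shows sets_boundary_intensity: "A \<in> sets (boundary_intensity n f)"
    and emeasure_boundary_intensity:
      "emeasure (boundary_intensity n f) A = of_nat n * emeasure lborel (A \<inter> {z. f (fst z) \<le> snd z})"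
proof -
  define S where "S = ({0..1} \<times> UNIV :: (real \<times> real) set)"
  have S: "S \<in> sets borel"
    unfolding S_def by (intro borel_closed closed_Times) auto
  have sets: "A \<in> sets (restrict_space lborel S)"
    using assms S by (auto simp: sets_restrict_space_iff S_def[symmetric])
  then show "A \<in> sets (boundary_intensity n f)"
    by (simp add: boundary_intensity_def S_def)
  have ind: "(\<lambda>(x, y). ennreal (real n * (if f x \<le> y then 1 else 0))) =
      (\<lambda>z. of_nat n * indicator {z. f (fst z) \<le> snd z} z)"
    by (auto simp: fun_eq_iff indicator_def ennreal_of_nat_eq_real_of_nat)
  have [measurable]: "{z. f (fst z) \<le> snd z} \<in> sets (borel :: (real \<times> real) measure)"
  proof -
    have "{z \<in> space (borel \<Otimes>\<^sub>M borel). f (fst z) \<le> snd z} \<in> sets (borel \<Otimes>\<^sub>M borel)"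
      by measurable
    then show ?thesis
      unfolding borel_prod by simp
  qed
  have "emeasure (boundary_intensity n f) A =
      (\<integral>\<^sup>+z. of_nat n * indicator {z. f (fst z) \<le> snd z} z * indicator A z \<partial>restrict_space lborel S)"
    unfolding boundary_intensity_def ind S_def[symmetric]
    by (rule emeasure_density) (use sets in \<open>auto intro!: measurable_restrict_space1\<close>)
  also have "\<dots> = (\<integral>\<^sup>+z. of_nat n * indicator (A \<inter> {z. f (fst z) \<le> snd z}) z \<partial>lborel)"
    using S assms(3) by (subst nn_integral_restrict_space)
      (auto simp: S_def[symmetric] indicator_def intro!: nn_integral_cong)
  also have "\<dots> = of_nat n * emeasure lborel (A \<inter> {z. f (fst z) \<le> snd z})"
    by (rule nn_integral_cmult_indicator) simp
  finally show "emeasure (boundary_intensity n f) A = of_nat n * emeasure lborel (A \<inter> {z. f (fst z) \<le> snd z})" .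
qed

lemma emeasure_lborel_Times:
  fixes A B :: "real set"
  assumes "A \<in> sets borel" "B \<in> sets borel"
  shows "emeasure lborel (A \<times> B) = emeasure lborel A * emeasure lborel B"
  unfolding lborel_prod[symmetric] using assms by (intro lborel.emeasure_pair_measure_Times) auto

subsection \<open>Posterior for a fixed partition\<close>

text \<open>One partition is fixed here, and the bounds below are explicit, so they can be used for
  every \<open>n\<close> with constants that do not depend on it. Nothing is known about
  \<open>t\<close> beyond index \<open>K\<close>. Since \<open>t 0\<close> and \<open>t K\<close>
  differ, \<open>K\<close> is positive.\<close>

locale partition =
  fixes K :: nat and t :: "nat \<Rightarrow> real"
  assumes t_0: "t 0 = 0" and t_K: "t K = 1" and t_less: "\<And>j. j < K \<Longrightarrow> t j < t (Suc j)"
begin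

section \<open>Cells of the partition and step functions\<close>

lemma t_mono: "i \<le> j \<Longrightarrow> j \<le> K \<Longrightarrow> t i \<le> t j"
proof (induction j rule: dec_induct)
  case (step j)
  then show ?case using t_less[of j] by simp
qed simp

lemma t_step: "j \<in> {1..K} \<Longrightarrow> t (j - 1) < t j"
  using t_less[of "j - 1"] by auto

lemma cell_subset: "j \<in> {1..K} \<Longrightarrow> {t (j - 1)..<t j} \<subseteq> {0..<1}"
proof -
  assume j: "j \<in> {1..K}"
  then have "j - 1 \<le> K" "j \<le> K" by auto
  with t_mono[of 0 "j - 1"] t_mono[of j K] have "0 \<le> t (j - 1)" "t j \<le> 1"
    by (simp_all add: t_0 t_K)
  then show ?thesis by auto
qed

lemma cell_disjoint:
  assumes "i \<in> {1..K}" "j \<in> {1..K}" "x \<in> {t (i - 1)..<t i}" "x \<in> {t (j - 1)..<t j}"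
  shows "i = j"
proof (rule ccontr)
  assume "i \<noteq> j"
  moreover have "j - 1 \<le> K" "i - 1 \<le> K" using assms by auto
  ultimately have "t i \<le> t (j - 1) \<or> t j \<le> t (i - 1)"
    using assms by (metis t_mono Suc_leI atLeastAtMost_iff linorder_neqE_nat Suc_le_mono Suc_diff_1 less_le_trans zero_less_one)
  then show False using assms by auto
qed

lemma cell_cover:
  assumes "x \<in> {0..<1}"
  obtains j where "j \<in> {1..K}" "x \<in> {t (j - 1)..<t j}"
proof -
  \<comment> \<open>The right end of the cell is the first partition point beyond \<open>x\<close>;
    it is not \<open>t 0 = 0\<close> because \<open>x\<close> is nonnegative.\<close>
  define j where "j = (LEAST j. x < t j)"
  have "x < t K" using assms by (simp add: t_K)
  then have j: "x < t j" "j \<le> K"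
    unfolding j_def by (auto intro: LeastI Least_le)
  have "j \<noteq> 0" using j assms by (auto simp: t_0 intro!: Nat.gr0I)
  moreover have "t (j - 1) \<le> x"
    using not_less_Least[of "j - 1" "\<lambda>j. x < t j"] \<open>j \<noteq> 0\<close> by (auto simp: j_def[symmetric])
  ultimately show thesis
    using j by (intro that[of j]) auto
qed

lemma step_function_cell:
  assumes "j \<in> {1..K}" "x \<in> {t (j - 1)..<t j}"
  shows "step_function K t a x = a j"
proof -
  have "step_function K t a x = (\<Sum>i=1..K. if i = j then a j else 0)"
    unfolding step_function_def
  proof (rule sum.cong[OF refl])
    show "a i * indicator {t (i - 1)..<t i} x = (if i = j then a j else 0)" if "i \<in> {1..K}" for i
      using cell_disjoint[OF that assms(1) _ assms(2)] assms(2) by (cases "i = j") (auto simp: indicator_def)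
  qed
  then show ?thesis
    using assms by simp
qed

lemma integral_step_function:
  "(LBINT x:{0..1}. step_function K t a x) = (\<Sum>j=1..K. a j * (t j - t (j - 1)))"
proof -
  have "(LBINT x:{0..1}. step_function K t a x) =
      (\<integral>x. (\<Sum>j=1..K. a j * indicator {t (j - 1)..<t j} x) \<partial>lborel)"
    unfolding set_lebesgue_integral_def
  proof (rule Bochner_Integration.integral_cong[OF refl])
    show "indicator {0..1} x *\<^sub>R step_function K t a x = (\<Sum>j=1..K. a j * indicator {t (j - 1)..<t j} x)" for x
      unfolding step_function_def scaleR_sum_right
    proof (rule sum.cong[OF refl])
      show "indicator {0..1} x *\<^sub>R (a j * indicator {t (j - 1)..<t j} x) = a j * indicator {t (j - 1)..<t j} x"
        if "j \<in> {1..K}" for j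
        using cell_subset[OF that] by (auto simp: indicator_def)
    qed
  qed
  also have "\<dots> = (\<Sum>j=1..K. \<integral>x. a j * indicator {t (j - 1)..<t j} x \<partial>lborel)"
  proof (rule Bochner_Integration.integral_sum)
    show "integrable lborel (\<lambda>x. a j * indicator {t (j - 1)..<t j} x)" if "j \<in> {1..K}" for j
      using t_step[OF that] by (intro integrable_mult_right integrable_real_indicator) auto
  qed
  also have "\<dots> = (\<Sum>j=1..K. a j * (t j - t (j - 1)))"
    using t_step by (intro sum.cong) (auto simp: less_imp_le)
  finally show ?thesis .
qed

text \<open>
  Outside the domain \<open>[0, 1)\<close> the step functions vanish, so a point with abscissa \<open>1\<close> would
  impose a spurious constraint; \<open>a_hat\<close> is junk for an empty or unbounded cell.
\<close>

definition regular :: "(nat \<Rightarrow> real \<times> real) \<Rightarrow> bool" where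
  "regular z \<longleftrightarrow> (\<forall>i. fst (z i) \<in> {0..<1}) \<and>
     (\<forall>j\<in>{1..K}. (\<exists>i. fst (z i) \<in> {t (j - 1)..<t j}) \<and>
        bdd_below ((\<lambda>i. snd (z i)) ` {i. fst (z i) \<in> {t (j - 1)..<t j}}))"

text \<open>This decouples the cells: the support constraint of the likelihood becomes one upper
  bound per coordinate. From left to right the infimum is a greatest lower bound because the cell is
  nonempty. From right to left it is a lower bound because the cell is bounded below, and every
  point lies in some cell.\<close>

lemma step_function_le_iff:
  assumes "regular z"
  shows "(\<forall>i. step_function K t a (fst (z i)) \<le> snd (z i)) \<longleftrightarrow> (\<forall>j\<in>{1..K}. a j \<le> a_hat t z j)"
proof
  assume *: "\<forall>i. step_function K t a (fst (z i)) \<le> snd (z i)"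
  show "\<forall>j\<in>{1..K}. a j \<le> a_hat t z j"
  proof
    fix j assume j: "j \<in> {1..K}"
    show "a j \<le> a_hat t z j"
      unfolding a_hat_def
    proof (rule cINF_greatest)
      show "{i. fst (z i) \<in> {t (j - 1)..<t j}} \<noteq> {}"
        using assms j by (auto simp: regular_def)
      show "a j \<le> snd (z i)" if "i \<in> {i. fst (z i) \<in> {t (j - 1)..<t j}}" for i
        using * that step_function_cell[OF j] by (metis mem_Collect_eq)
    qed
  qed
next
  assume *: "\<forall>j\<in>{1..K}. a j \<le> a_hat t z j"
  show "\<forall>i. step_function K t a (fst (z i)) \<le> snd (z i)"
  proof
    fix i
    obtain j where j: "j \<in> {1..K}" "fst (z i) \<in> {t (j - 1)..<t j}"
      using assms cell_cover by (metis regular_def)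
    have "a_hat t z j \<le> snd (z i)"
      unfolding a_hat_def using assms j by (intro cINF_lower) (auto simp: regular_def)
    then show "step_function K t a (fst (z i)) \<le> snd (z i)"
      using * j step_function_cell[OF j] by fastforce
  qed
qed

text \<open>As a function of \<open>a j\<close>, the likelihood factor
  \<open>exp (l j * a j)\<close> cut off at \<open>a_hat t z j\<close> is the reflected exponential
  density \<open>q j\<close> up to the constant \<open>exp (l j * a_hat t z j) / l j\<close>. The
  product \<open>C\<close> of these constants cancels against the normalization, which is
  \<open>C\<close> times the product of the \<open>Z j\<close>.\<close>

lemma posterior_eq_density:
  fixes g :: "real \<Rightarrow> real"
  assumes "0 < n" and z: "regular z" and g: "integrable lborel g" "\<And>x. 0 < g x"
  defines "q \<equiv> \<lambda>j x. exponential_density (real n * (t j - t (j - 1))) (a_hat t z j - x)"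
  defines "Z \<equiv> \<lambda>j. \<integral>x. q j x * g x \<partial>lborel"
  assumes Z: "\<And>j. j \<in> {1..K} \<Longrightarrow> 0 < Z j" and qg: "\<And>j. j \<in> {1..K} \<Longrightarrow> integrable lborel (\<lambda>x. q j x * g x)"
  shows "posterior n g K t z = density (lebesgue_prod K) (\<lambda>a. ennreal (\<Prod>j=1..K. q j (a j) * g (a j) / Z j))"
proof -
  interpret product_sigma_finite "\<lambda>_::nat. lborel :: real measure" ..
  define l where "l j = real n * (t j - t (j - 1))" for j
  define C where "C = (\<Prod>j=1..K. exp (l j * a_hat t z j) / l j)"
  have l: "0 < l j" if "j \<in> {1..K}" for j
    using t_step[OF that] \<open>0 < n\<close> by (simp add: l_def)
  have q: "0 \<le> q j x" if "j \<in> {1..K}" for j x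
    using l[OF that] by (auto simp: q_def exponential_density_def l_def)
  have C: "0 < C"
    using l by (auto simp: C_def intro!: prod_pos)
  have Zp: "0 < (\<Prod>j=1..K. Z j)"
    using Z by (auto intro!: prod_pos)
  have w: "posterior_weight n g K t z a = C * (\<Prod>j=1..K. q j (a j) * g (a j))" for a
  proof -
    have "posterior_weight n g K t z a = exp (\<Sum>j=1..K. l j * a j) *
        (if \<forall>j\<in>{1..K}. a j \<le> a_hat t z j then 1 else 0) * (\<Prod>j=1..K. g (a j))"
      unfolding posterior_weight_def integral_step_function step_function_le_iff[OF z]
      by (simp add: l_def sum_distrib_left mult_ac)
    also have "(if \<forall>j\<in>{1..K}. a j \<le> a_hat t z j then 1 else 0) =
        (\<Prod>j=1..K. if a j \<le> a_hat t z j then 1 else 0 :: real)"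
      by (auto intro!: prod_zero[symmetric])
    also have "exp (\<Sum>j=1..K. l j * a j) * (\<Prod>j=1..K. if a j \<le> a_hat t z j then 1 else 0) * (\<Prod>j=1..K. g (a j)) =
        (\<Prod>j=1..K. exp (l j * a j) * (if a j \<le> a_hat t z j then 1 else 0) * g (a j))"
      by (simp add: exp_sum prod.distrib)
    also have "\<dots> = (\<Prod>j=1..K. exp (l j * a_hat t z j) / l j * (q j (a j) * g (a j)))"
    proof (rule prod.cong[OF refl])
      fix j assume "j \<in> {1..K}"
      then have "l j \<noteq> 0" using l by force
      have "exp (l j * a j) = exp (l j * a_hat t z j) * exp (- (a_hat t z j - a j) * l j)"
        by (simp add: exp_add[symmetric] algebra_simps)
      then show "exp (l j * a j) * (if a j \<le> a_hat t z j then 1 else 0) * g (a j) =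
          exp (l j * a_hat t z j) / l j * (q j (a j) * g (a j))"
        using \<open>l j \<noteq> 0\<close> unfolding q_def l_def[symmetric] exponential_density_def by simp
    qed
    finally show ?thesis
      unfolding C_def prod.distrib .
  qed
  have int: "integrable (lebesgue_prod K) (\<lambda>a. \<Prod>j=1..K. q j (a j) * g (a j))"
    using qg by (intro product_integrable_prod) auto
  have nn: "0 \<le> (\<Prod>j=1..K. q j (a j) * g (a j))" for a
    using q less_imp_le[OF g(2)] by (intro prod_nonneg) auto
  have D: "(\<integral>\<^sup>+ a. ennreal (posterior_weight n g K t z a) \<partial>lebesgue_prod K) = ennreal (C * (\<Prod>j=1..K. Z j))"
    unfolding w
  proof (subst nn_integral_eq_integral)
    show "ennreal (\<integral>a. C * (\<Prod>j=1..K. q j (a j) * g (a j)) \<partial>lebesgue_prod K) = ennreal (C * (\<Prod>j=1..K. Z j))"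
      using product_integral_prod[of "{1..K}" "\<lambda>j x. q j x * g x"] qg by (simp add: Z_def)
  qed (use int nn C in auto)
  have "ennreal (posterior_weight n g K t z a) / ennreal (C * (\<Prod>j=1..K. Z j)) =
      ennreal (\<Prod>j=1..K. q j (a j) * g (a j) / Z j)" for a
    unfolding w using C Zp nn by (subst divide_ennreal) (auto simp: prod_dividef)
  then show ?thesis
    unfolding posterior_def D by simp
qed

lemma shifted_exponential_eq_density:
  assumes "0 < n"
  shows "shifted_exponential n K t z = density (lebesgue_prod K)
    (\<lambda>a. ennreal (\<Prod>j=1..K. exponential_density (real n * (t j - t (j - 1))) (a_hat t z j - a j)))"
proof -
  define E where "E j = exponential_density (real n * (t j - t (j - 1)))" for j
  define A where "A j = a_hat t z j" for j
  have l: "0 < real n * (t j - t (j - 1))" if "j \<in> {1..K}" for j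
    using t_step[OF that] assms by simp
  have [measurable]: "E j \<in> borel_measurable borel" for j
    unfolding E_def by measurable
  have E: "0 \<le> E j x" if "j \<in> {1..K}" for j x
    using l[OF that] unfolding E_def exponential_density_def by auto
  have prob: "prob_space (density lborel (\<lambda>x. ennreal (E j x)))" if "j \<in> {1..K}" for j
    unfolding E_def using l[OF that] by (rule prob_space_exponential_density)
  have d: "distr (density lborel (\<lambda>x. ennreal (E j x))) lborel (\<lambda>x. A j - x) =
      density lborel (\<lambda>x. ennreal (E j (A j - x)))" for j
  proof -
    \<comment> \<open>The reflection preserves Lebesgue measure and is its own inverse, so
      transporting the density back evaluates it at \<open>A j - (A j - x) = x\<close>.\<close>
    have "distr lborel lborel (\<lambda>x. A j - x) = lborel"
    proof -
      have "lborel = density (distr lborel borel (\<lambda>x. A j + - 1 * x)) (\<lambda>_. \<bar>- 1 :: real\<bar>)"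
        by (rule lborel_real_affine) simp
      then show ?thesis
        by (simp add: density_1 cong: distr_cong)
    qed
    then have "density lborel (\<lambda>x. ennreal (E j (A j - x))) =
        density (distr lborel lborel (\<lambda>x. A j - x)) (\<lambda>x. ennreal (E j (A j - x)))"
      by simp
    also have "\<dots> = distr (density lborel (\<lambda>x. ennreal (E j x))) lborel (\<lambda>x. A j - x)"
      by (subst density_distr) auto
    finally show ?thesis by simp
  qed
  have "shifted_exponential n K t z = distr (Pi\<^sub>M {1..K} (\<lambda>j. density lborel (\<lambda>x. ennreal (E j x))))
      (lebesgue_prod K) (\<lambda>\<eta>. \<lambda>j\<in>{1..K}. A j - \<eta> j)"
    by (simp add: shifted_exponential_def E_def A_def)
  also have "\<dots> = Pi\<^sub>M {1..K} (\<lambda>j. density lborel (\<lambda>x. ennreal (E j (A j - x))))"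
    by (subst distr_PiM_components) (use prob d in auto)
  also have "\<dots> = density (lebesgue_prod K) (\<lambda>a. \<Prod>j=1..K. ennreal (E j (A j - a j)))"
  proof (rule density_PiM[symmetric])
    show "prob_space (density lborel (\<lambda>x. ennreal (E j (A j - x))))" if "j \<in> {1..K}" for j
      unfolding d[symmetric] using prob[OF that] by (rule prob_space.prob_space_distr) simp
  qed (auto simp: product_sigma_finite_def lborel.sigma_finite_measure_axioms)
  also have "\<dots> = density (lebesgue_prod K) (\<lambda>a. ennreal (\<Prod>j=1..K. E j (A j - a j)))"
    using E by (subst prod_ennreal) auto
  finally show ?thesis
    unfolding E_def A_def .
qed

section \<open>Total variation distance to the limit law, first for a fixed configuration, then in
  expectation\<close>

lemma prob_space_shifted_exponential:
  assumes "0 < n"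
  shows "prob_space (shifted_exponential n K t z)"
proof -
  have "prob_space (density lborel (exponential_density (real n * (t j - t (j - 1)))))" if "j \<in> {1..K}" for j
    using t_step[OF that] assms by (intro prob_space_exponential_density) simp
  then show ?thesis
    unfolding shifted_exponential_def
    by (intro prob_space.prob_space_distr prob_space_PiM) auto
qed

text \<open>This is the trivial bound for the exceptional event. The configuration is arbitrary, so
  the normalizing constant may be 0 or infinite; in \<open>ennreal\<close> the quotient
  \<open>?D / ?D\<close> is then 0, and otherwise it is 1.\<close>

lemma tv_norm_posterior_le_1:
  assumes "0 < n" and g: "g \<in> borel_measurable borel"
  shows "tv_norm (posterior n g K t z) (shifted_exponential n K t z) \<le> 1"
proof (rule tv_norm_le_1)
  fix B assume "B \<in> sets (posterior n g K t z)"
  then have B: "B \<in> sets (lebesgue_prod K)" by (simp add: posterior_def)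
  let ?w = "\<lambda>a. ennreal (posterior_weight n g K t z a)"
  let ?D = "\<integral>\<^sup>+ a. ?w a \<partial>lebesgue_prod K"
  have "emeasure (posterior n g K t z) B \<le> ?D / ?D"
    unfolding emeasure_posterior[OF g B]
    by (intro divide_right_mono_ennreal nn_integral_mono) (auto simp: indicator_def)
  also have "\<dots> \<le> 1"
    using ennreal_divide_self[of ?D] by (cases "?D = 0 \<or> ?D = \<top>") (auto simp: less_top)
  finally show "measure (posterior n g K t z) B \<le> 1"
    unfolding measure_def by (metis enn2real_leI ennreal_1 zero_le_one)
next
  show "measure (shifted_exponential n K t z) B \<le> 1" for B
    using prob_space_shifted_exponential[OF assms(1)] by (rule prob_space.prob_le_1)
qed

text \<open>Tilting and the telescoping bound are combined. By \<open>small\<close> each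
  normalization \<open>Z j\<close> differs from \<open>g (a_hat t z j)\<close> by at most
  \<open>c / 2\<close> and so stays above \<open>c / 2\<close>. Each coordinate then costs
  \<open>2 * e / Z j\<close> with \<open>e\<close> at most \<open>2 * L * m powr - \<beta>\<close>,
  which produces the constant 8.\<close>

lemma tv_norm_posterior_le:
  fixes g :: "real \<Rightarrow> real"
  assumes n: "0 < n" and z: "regular z" and g: "integrable lborel g" "\<And>x. 0 < g x"
    and \<beta>: "0 < \<beta>" "\<beta> \<le> 1" and L: "0 \<le> L" "\<And>x y. \<bar>g x - g y\<bar> \<le> L * \<bar>x - y\<bar> powr \<beta>"
    and c: "0 < c" "\<And>j. j \<in> {1..K} \<Longrightarrow> c \<le> g (a_hat t z j)"
    and m: "0 < m" "\<And>j. j \<in> {1..K} \<Longrightarrow> m \<le> real n * (t j - t (j - 1))"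
    and small: "2 * L * m powr - \<beta> \<le> c / 2"
  shows "tv_norm (posterior n g K t z) (shifted_exponential n K t z) \<le> real K * (8 * L * m powr - \<beta> / c)"
proof -
  interpret product_sigma_finite "\<lambda>_::nat. lborel :: real measure" ..
  define l where "l j = real n * (t j - t (j - 1))" for j
  define q where "q j x = exponential_density (l j) (a_hat t z j - x)" for j x
  define Z where "Z j = (\<integral>x. q j x * g x \<partial>lborel)" for j
  define p where "p j x = q j x * g x / Z j" for j x
  have l: "0 < l j" if "j \<in> {1..K}" for j
    using t_step[OF that] n by (simp add: l_def)
  have q: "0 \<le> q j x" if "j \<in> {1..K}" for j x
    using l[OF that] by (auto simp: q_def exponential_density_def)
  have qi: "integrable lborel (q j)" "integral\<^sup>L lborel (q j) = 1" if "j \<in> {1..K}" for j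
    unfolding q_def using l[OF that]
    by (rule integrable_reflected_exponential, intro integral_reflected_exponential) (rule l[OF that])
  note tilt = exponential_tilt[OF l g(1) less_imp_le[OF g(2)] \<beta> L]
  have qg: "integrable lborel (\<lambda>x. q j x * g x)" if "j \<in> {1..K}" for j
    unfolding q_def by (rule tilt(1)[OF that])
  have lm: "l j powr - \<beta> \<le> m powr - \<beta>" if "j \<in> {1..K}" for j
    using m(1) m(2)[OF that] \<beta> by (intro powr_mono2') (auto simp: l_def)
  have Zc: "c / 2 \<le> Z j" if "j \<in> {1..K}" for j
  proof -
    have "\<bar>Z j - g (a_hat t z j)\<bar> \<le> 2 * L * l j powr - \<beta>"
      unfolding Z_def q_def by (rule tilt(2)[OF that])
    also have "\<dots> \<le> 2 * L * m powr - \<beta>"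
      using lm[OF that] L(1) by (intro mult_left_mono) auto
    finally show ?thesis
      using small c(2)[OF that] by linarith
  qed
  then have Z: "0 < Z j" if "j \<in> {1..K}" for j
    using that c(1) by (meson half_gt_zero less_le_trans)
  have p: "integrable lborel (p j)" "integral\<^sup>L lborel (p j) = 1" "\<And>x. 0 \<le> p j x" if "j \<in> {1..K}" for j
    using qg[OF that] Z[OF that] q[OF that] less_imp_le[OF g(2)] unfolding p_def by (auto simp: Z_def[symmetric])
  have P: "posterior n g K t z = density (lebesgue_prod K) (\<lambda>a. ennreal (\<Prod>j=1..K. p j (a j)))"
    unfolding p_def Z_def q_def l_def
    by (rule posterior_eq_density[OF n z g]) (use Z qg in \<open>simp_all add: Z_def q_def l_def\<close>)
  have Q: "shifted_exponential n K t z = density (lebesgue_prod K) (\<lambda>a. ennreal (\<Prod>j=1..K. q j (a j)))"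
    unfolding q_def l_def by (rule shifted_exponential_eq_density[OF n])
  have "tv_norm (posterior n g K t z) (shifted_exponential n K t z) \<le>
      (\<integral>a. \<bar>(\<Prod>j=1..K. p j (a j)) - (\<Prod>j=1..K. q j (a j))\<bar> \<partial>lebesgue_prod K)"
    unfolding P Q
  proof (rule tv_norm_density_le)
    show "integrable (lebesgue_prod K) (\<lambda>a. \<Prod>j=1..K. p j (a j))"
      using p by (intro product_integrable_prod) auto
    show "integrable (lebesgue_prod K) (\<lambda>a. \<Prod>j=1..K. q j (a j))"
      using qi by (intro product_integrable_prod) auto
    show "0 \<le> (\<Prod>j=1..K. p j (a j))" "0 \<le> (\<Prod>j=1..K. q j (a j))" for a
      using p q by (auto intro!: prod_nonneg)
  qed
  also have "\<dots> \<le> (\<Sum>j=1..K. \<integral>x. \<bar>p j x - q j x\<bar> \<partial>lborel)"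
    using p qi q by (intro integral_abs_prod_diff_le) auto
  also have "\<dots> \<le> (\<Sum>j=1..K. 8 * L * m powr - \<beta> / c)"
  proof (rule sum_mono)
    fix j assume j: "j \<in> {1..K}"
    have "(\<integral>x. \<bar>p j x - q j x\<bar> \<partial>lborel) \<le> 2 * (2 * L * l j powr - \<beta>) / Z j"
      using Z[OF j] unfolding p_def Z_def q_def by (rule tilt(3)[OF j])
    also have "\<dots> \<le> 2 * (2 * L * m powr - \<beta>) / (c / 2)"
      using lm[OF j] L(1) c(1) Zc[OF j] by (intro frac_le mult_left_mono) auto
    also have "\<dots> = 8 * L * m powr - \<beta> / c"
      by simp
    finally show "(\<integral>x. \<bar>p j x - q j x\<bar> \<partial>lborel) \<le> 8 * L * m powr - \<beta> / c" .
  qed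
  also have "\<dots> = real K * (8 * L * m powr - \<beta> / c)"
    by simp
  finally show ?thesis .
qed

text \<open>Three things can go wrong: a point with abscissa 1 (\<open>S\<close>), a point below the
  graph (\<open>B\<close>), or an empty box \<open>C j\<close> above the graph on some cell. The
  first two regions have intensity 0, and the box has intensity
  \<open>n * (t j - t (j - 1))\<close>, so its void probability is at most \<open>exp (- m)\<close>.
  Stating the result through a measurable set \<open>E\<close> avoids any claim about the
  measurability of \<open>a_hat\<close>.\<close>

lemma a_hat_concentration:
  assumes n: "0 < n" and m: "\<And>j. j \<in> {1..K} \<Longrightarrow> m \<le> real n * (t j - t (j - 1))"
    and ppp: "poisson_point_process M Z (boundary_intensity n (step_function K t a))"
  obtains E where "E \<in> sets M" "emeasure M E \<le> ennreal (real K * exp (- m))"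
    "\<And>\<omega>. \<omega> \<in> space M - E \<Longrightarrow> regular (\<lambda>i. Z i \<omega>)"
    "\<And>\<omega> j. \<omega> \<in> space M - E \<Longrightarrow> j \<in> {1..K} \<Longrightarrow> a_hat t (\<lambda>i. Z i \<omega>) j \<in> {a j..a j + 1}"
proof -
  let ?f = "step_function K t a"
  let ?\<Lambda> = "boundary_intensity n ?f"
  interpret prob_space M using ppp by (simp add: poisson_point_process_def)
  have f[measurable]: "?f \<in> borel_measurable borel"
    unfolding step_function_def by measurable
  define V where "V A = {\<omega>\<in>space M. \<forall>i. Z i \<omega> \<notin> A}" for A
  define S where "S = ({1} \<times> UNIV :: (real \<times> real) set)"
  define B where "B = ({0..1} \<times> UNIV) \<inter> {z. snd z < ?f (fst z)}"
  \<comment> \<open>Height 1 makes the area of the box equal to the cell length and confines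
    \<open>a_hat\<close> to a bounded interval.\<close>
  define C where "C j = {t (j - 1)..<t j} \<times> {a j..a j + 1}" for j
  have S[measurable]: "S \<in> sets borel"
    unfolding S_def by (intro borel_closed closed_Times) auto
  have B[measurable]: "B \<in> sets borel"
  proof -
    have "{z \<in> space (borel \<Otimes>\<^sub>M borel). snd z < ?f (fst z)} \<in> sets (borel \<Otimes>\<^sub>M borel)"
      by measurable
    moreover have "{0..1} \<times> UNIV \<in> sets (borel :: (real \<times> real) measure)"
      by (intro borel_closed closed_Times) auto
    ultimately show ?thesis
      unfolding B_def borel_prod by simp
  qed
  have [measurable]: "C j \<in> sets borel" for j
    unfolding C_def borel_prod[symmetric] by (intro pair_measureI) auto
  have C_sub: "C j \<subseteq> {0..1} \<times> UNIV" if "j \<in> {1..K}" for j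
    using cell_subset[OF that] by (auto simp: C_def)
  have "emeasure lborel (S \<inter> {z. ?f (fst z) \<le> snd z}) \<le> emeasure lborel S"
    by (rule emeasure_mono) auto
  also have "\<dots> = 0"
    unfolding S_def by (subst emeasure_lborel_Times) auto
  finally have eS: "emeasure ?\<Lambda> S = 0"
    by (subst emeasure_boundary_intensity[OF f S]) (auto simp: S_def)
  have "B \<inter> {z. ?f (fst z) \<le> snd z} = {}" by (auto simp: B_def)
  then have eB: "emeasure ?\<Lambda> B = 0"
    by (subst emeasure_boundary_intensity[OF f B]) (auto simp: B_def)
  have eC: "emeasure ?\<Lambda> (C j) = ennreal (real n * (t j - t (j - 1)))" if j: "j \<in> {1..K}" for j
  proof -
    have "C j \<inter> {z. ?f (fst z) \<le> snd z} = C j"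
      using step_function_cell[OF j] by (auto simp: C_def)
    then have "emeasure ?\<Lambda> (C j) = of_nat n * emeasure lborel (C j)"
      using C_sub[OF j] by (subst emeasure_boundary_intensity) auto
    also have "emeasure lborel (C j) = ennreal (t j - t (j - 1))"
      unfolding C_def using t_step[OF j] by (subst emeasure_lborel_Times) auto
    also have "of_nat n * \<dots> = ennreal (real n * (t j - t (j - 1)))"
      by (simp add: ennreal_of_nat_eq_real_of_nat ennreal_mult')
    finally show ?thesis .
  qed
  have VC: "V (C j) \<in> sets M" "emeasure M (V (C j)) = ennreal (exp (- (real n * (t j - t (j - 1)))))"
    if j: "j \<in> {1..K}" for j
  proof -
    have "measure ?\<Lambda> (C j) = real n * (t j - t (j - 1))"
      using eC[OF j] t_step[OF j] by (simp add: measure_def)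
    then show "V (C j) \<in> sets M" "emeasure M (V (C j)) = ennreal (exp (- (real n * (t j - t (j - 1)))))"
      using poisson_void_probability[OF ppp sets_boundary_intensity[OF f _ C_sub[OF j]]] eC[OF j]
      by (simp_all add: V_def)
  qed
  \<comment> \<open>A region of intensity 0 has void probability \<open>exp 0 = 1\<close>.\<close>
  have null: "V A \<in> sets M" "emeasure M (space M - V A) = 0"
    if "A \<in> sets borel" "A \<subseteq> {0..1} \<times> UNIV" "emeasure ?\<Lambda> A = 0" for A
  proof -
    note void = poisson_void_probability[OF ppp sets_boundary_intensity[OF f that(1,2)]]
    show V: "V A \<in> sets M"
      unfolding V_def using that by (intro void) auto
    have "emeasure M (V A) = 1"
      unfolding V_def using that by (subst void) (auto simp: measure_def)
    then show "emeasure M (space M - V A) = 0"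
      using V by (simp add: emeasure_compl emeasure_space_1)
  qed
  note nullS = null[OF _ _ eS] and nullB = null[OF _ _ eB]
  have SB: "S \<subseteq> {0..1} \<times> UNIV" "B \<subseteq> {0..1} \<times> UNIV"
    by (auto simp: S_def B_def)
  define E where "E = (space M - V S) \<union> (space M - V B) \<union> (\<Union>j\<in>{1..K}. V (C j))"
  have E: "E \<in> sets M"
    unfolding E_def using nullS nullB VC SB by auto
  have "emeasure M E \<le> emeasure M (space M - V S) + emeasure M (space M - V B) + emeasure M (\<Union>j\<in>{1..K}. V (C j))"
    unfolding E_def using nullS nullB VC SB
    by (intro order.trans[OF emeasure_subadditive] add_right_mono emeasure_subadditive) auto
  also have "\<dots> = emeasure M (\<Union>j\<in>{1..K}. V (C j))"
    using nullS nullB SB by simp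
  also have "\<dots> \<le> (\<Sum>j\<in>{1..K}. emeasure M (V (C j)))"
    using VC by (intro emeasure_subadditive_finite) auto
  also have "\<dots> \<le> (\<Sum>j\<in>{1..K}. ennreal (exp (- m)))"
    using VC(2) m by (intro sum_mono) (auto intro!: ennreal_leI)
  also have "\<dots> = ennreal (real K * exp (- m))"
    by (simp add: ennreal_mult ennreal_of_nat_eq_real_of_nat)
  finally have PE: "emeasure M E \<le> ennreal (real K * exp (- m))" .
  have good: "regular (\<lambda>i. Z i \<omega>) \<and> (\<forall>j\<in>{1..K}. a_hat t (\<lambda>i. Z i \<omega>) j \<in> {a j..a j + 1})"
    if \<omega>: "\<omega> \<in> space M - E" for \<omega>
  proof -
    have sp: "fst (Z i \<omega>) \<in> {0..1}" for i
    proof -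
      have "Z i \<in> M \<rightarrow>\<^sub>M ?\<Lambda>" using ppp by (simp add: poisson_point_process_def)
      then have "Z i \<omega> \<in> space ?\<Lambda>" using \<omega> by (auto dest: measurable_space)
      then show ?thesis by (auto simp: space_boundary_intensity)
    qed
    have noS: "Z i \<omega> \<notin> S" and noB: "Z i \<omega> \<notin> B" for i
      using \<omega> by (auto simp: E_def V_def)
    have hit: "\<exists>i. Z i \<omega> \<in> C j" if "j \<in> {1..K}" for j
      using \<omega> that by (auto simp: E_def V_def)
    have fst: "fst (Z i \<omega>) \<in> {0..<1}" for i
      using sp[of i] noS[of i] by (cases "Z i \<omega>") (auto simp: S_def)
    have above: "a j \<le> snd (Z i \<omega>)" if "j \<in> {1..K}" "fst (Z i \<omega>) \<in> {t (j - 1)..<t j}" for i j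
      using step_function_cell[OF that] noB[of i] sp[of i] by (cases "Z i \<omega>") (auto simp: B_def)
    have bdd: "bdd_below ((\<lambda>i. snd (Z i \<omega>)) ` {i. fst (Z i \<omega>) \<in> {t (j - 1)..<t j}})" if "j \<in> {1..K}" for j
      using above[OF that] by (auto intro!: bdd_belowI[of _ "a j"])
    have ne: "\<exists>i. fst (Z i \<omega>) \<in> {t (j - 1)..<t j} \<and> snd (Z i \<omega>) \<le> a j + 1" if "j \<in> {1..K}" for j
      using hit[OF that] by (auto simp: C_def mem_Times_iff)
    have "a_hat t (\<lambda>i. Z i \<omega>) j \<in> {a j..a j + 1}" if j: "j \<in> {1..K}" for j
    proof -
      obtain i where i: "fst (Z i \<omega>) \<in> {t (j - 1)..<t j}" "snd (Z i \<omega>) \<le> a j + 1"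
        using ne[OF j] by blast
      have "a_hat t (\<lambda>i. Z i \<omega>) j \<le> snd (Z i \<omega>)"
        unfolding a_hat_def using i bdd[OF j] by (intro cINF_lower) auto
      moreover have "a j \<le> a_hat t (\<lambda>i. Z i \<omega>) j"
        unfolding a_hat_def using i above[OF j] by (intro cINF_greatest) auto
      ultimately show ?thesis using i by simp
    qed
    moreover have "regular (\<lambda>i. Z i \<omega>)"
      unfolding regular_def
    proof (intro conjI allI ballI)
      show "\<exists>i. fst (Z i \<omega>) \<in> {t (j - 1)..<t j}" if "j \<in> {1..K}" for j
        using ne[OF that] by (elim exE conjE) (rule exI)
    qed (rule fst, rule bdd)
    ultimately show ?thesis
      by (intro conjI ballI)
  qed
  show thesis
    by (rule that[OF E PE]) (use good in blast)+
qed

text \<open>The distance is at most 1 on the exceptional event and at most \<open>\<delta>\<close>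
  off it. The upper integral is monotone without measurability of the distance in
  \<open>\<omega>\<close>; only the event \<open>E\<close> has to be measurable.\<close>

lemma expected_tv_norm_le:
  fixes g :: "real \<Rightarrow> real"
  assumes n: "0 < n" and g: "integrable lborel g" "\<And>x. 0 < g x"
    and \<beta>: "0 < \<beta>" "\<beta> \<le> 1" and L: "0 \<le> L" "\<And>x y. \<bar>g x - g y\<bar> \<le> L * \<bar>x - y\<bar> powr \<beta>"
    and c: "0 < c" "\<And>x. x \<in> {- R..R + 1} \<Longrightarrow> c \<le> g x"
    and m: "1 \<le> m" "\<And>j. j \<in> {1..K} \<Longrightarrow> m \<le> real n * (t j - t (j - 1))"
    and small: "2 * L * m powr - \<beta> \<le> c / 2"
    and f: "f \<in> PC_star K t R" and ppp: "poisson_point_process M Z (boundary_intensity n f)"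
  shows "(\<integral>\<^sup>+ \<omega>. ennreal (tv_norm (posterior n g K t (\<lambda>i. Z i \<omega>)) (shifted_exponential n K t (\<lambda>i. Z i \<omega>))) \<partial>M)
    \<le> ennreal ((1 + 8 * L / c) * (real K * m powr - \<beta>))"
proof -
  interpret prob_space M using ppp by (simp add: poisson_point_process_def)
  obtain a where a: "f = step_function K t a" "\<And>j. j \<in> {1..K} \<Longrightarrow> \<bar>a j\<bar> \<le> R"
    using f by (auto simp: PC_star_def)
  obtain E where E: "E \<in> sets M" "emeasure M E \<le> ennreal (real K * exp (- m))"
    "\<And>\<omega>. \<omega> \<in> space M - E \<Longrightarrow> regular (\<lambda>i. Z i \<omega>)"
    "\<And>\<omega> j. \<omega> \<in> space M - E \<Longrightarrow> j \<in> {1..K} \<Longrightarrow> a_hat t (\<lambda>i. Z i \<omega>) j \<in> {a j..a j + 1}"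
    using a_hat_concentration[OF n m(2)] ppp a(1) by metis
  define \<delta> where "\<delta> = real K * (8 * L * m powr - \<beta> / c)"
  have \<delta>: "0 \<le> \<delta>" using L c by (simp add: \<delta>_def)
  have *: "tv_norm (posterior n g K t (\<lambda>i. Z i \<omega>)) (shifted_exponential n K t (\<lambda>i. Z i \<omega>)) \<le> indicator E \<omega> + \<delta>"
    (is "?tv \<le> _") if "\<omega> \<in> space M" for \<omega>
  proof (cases "\<omega> \<in> E")
    case True
    have "?tv \<le> 1"
      using n g by (intro tv_norm_posterior_le_1) auto
    then show ?thesis using True \<delta> by simp
  next
    case False
    then have \<omega>: "\<omega> \<in> space M - E" using that by simp
    have "?tv \<le> \<delta>"
      unfolding \<delta>_def
    proof (rule tv_norm_posterior_le[OF n E(3)[OF \<omega>] g \<beta> L c(1) _ _ m(2) small])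
      show "c \<le> g (a_hat t (\<lambda>i. Z i \<omega>) j)" if "j \<in> {1..K}" for j
        using E(4)[OF \<omega> that] a(2)[OF that] by (intro c) auto
    qed (use m in auto)
    then show ?thesis using False by simp
  qed
  have "(\<integral>\<^sup>+ \<omega>. ennreal (tv_norm (posterior n g K t (\<lambda>i. Z i \<omega>)) (shifted_exponential n K t (\<lambda>i. Z i \<omega>))) \<partial>M)
      \<le> (\<integral>\<^sup>+ \<omega>. indicator E \<omega> + ennreal \<delta> \<partial>M)"
  proof (intro nn_integral_mono)
    fix \<omega> assume "\<omega> \<in> space M"
    then have "ennreal (tv_norm (posterior n g K t (\<lambda>i. Z i \<omega>)) (shifted_exponential n K t (\<lambda>i. Z i \<omega>)))
        \<le> ennreal (indicator E \<omega> + \<delta>)"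
      by (intro ennreal_leI *)
    also have "\<dots> = indicator E \<omega> + ennreal \<delta>"
      using \<delta> by (simp add: ennreal_plus ennreal_indicator)
    finally show "ennreal (tv_norm (posterior n g K t (\<lambda>i. Z i \<omega>)) (shifted_exponential n K t (\<lambda>i. Z i \<omega>)))
        \<le> indicator E \<omega> + ennreal \<delta>" .
  qed
  also have "\<dots> = emeasure M E + ennreal \<delta>"
    using E(1) by (simp add: nn_integral_add emeasure_space_1)
  also have "\<dots> \<le> ennreal (real K * exp (- m)) + ennreal \<delta>"
    using E(2) by (rule add_right_mono)
  also have "\<dots> = ennreal (real K * exp (- m) + \<delta>)"
    using \<delta> by (simp add: ennreal_plus)
  \<comment> \<open>For \<open>m \<ge> 1\<close> and \<open>\<beta> \<le> 1\<close>,
    \<open>m powr \<beta> \<le> m \<le> exp m\<close>, so the exceptional probability is absorbed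
    into the main rate.\<close>
  also have "\<dots> \<le> ennreal (real K * m powr - \<beta> + \<delta>)"
  proof -
    have "m powr \<beta> \<le> m powr 1"
      using m \<beta> by (intro powr_mono) auto
    also have "\<dots> \<le> exp m"
      using m exp_ge_add_one_self[of m] by (simp del: exp_ge_add_one_self)
    finally have "exp (- m) \<le> m powr - \<beta>"
      using m by (simp add: exp_minus powr_minus le_imp_inverse_le)
    then show ?thesis
      by (intro ennreal_leI add_right_mono mult_left_mono) auto
  qed
  also have "real K * m powr - \<beta> + \<delta> = (1 + 8 * L / c) * (real K * m powr - \<beta>)"
    by (simp add: \<delta>_def algebra_simps)
  finally show ?thesis .
qed

end

text \<open>The bound of \<open>expected_tv_norm_le\<close> depends on the true function only
  through \<open>R\<close>, by way of the constant \<open>c\<close>. It therefore passes to the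
  supremum, and the mesh condition sends it to 0.\<close>

theorem theorem4p1:
  fixes R \<beta> :: real
    and K :: "nat \<Rightarrow> nat"
    and t :: "nat \<Rightarrow> nat \<Rightarrow> real"
    and g :: "real \<Rightarrow> real"
    and P :: "nat \<Rightarrow> (real \<Rightarrow> real) \<Rightarrow> 'w measure"
    and Z :: "nat \<Rightarrow> (real \<Rightarrow> real) \<Rightarrow> nat \<Rightarrow> 'w \<Rightarrow> real \<times> real"
  assumes "R > 0"
    and "\<And>n. K n > 0"
    and "\<And>n. t n 0 = 0" and "\<And>n. t n (K n) = 1"
    and "\<And>n j. j < K n \<Longrightarrow> t n j < t n (Suc j)"
    and "0 < \<beta>" and "\<beta> \<le> 1"
    and "has_bochner_integral lborel g 1"
    and "\<And>x. g x > 0"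
    and "hoelder_continuous \<beta> g"
    and "\<And>n f. n > 0 \<Longrightarrow> f \<in> PC_star (K n) (t n) R \<Longrightarrow>
           poisson_point_process (P n f) (Z n f) (boundary_intensity n f)"
    and "(\<lambda>n. ennreal (real n * (INF j\<in>{1..K n}. \<bar>t n j - t n (j - 1)\<bar>)) /
              ennreal (real (K n) powr (1 / \<beta>) * ln (real (K n))))
           \<longlonglongrightarrow> \<infinity>"
  shows "(\<lambda>n. SUP f\<^sub>0 \<in> PC_star (K n) (t n) R.
             \<integral>\<^sup>+ \<omega>. ennreal (tv_norm (posterior n g (K n) (t n) (\<lambda>i. Z n f\<^sub>0 i \<omega>))
                                (shifted_exponential n (K n) (t n) (\<lambda>i. Z n f\<^sub>0 i \<omega>)))
               \<partial>P n f\<^sub>0) \<longlonglongrightarrow> 0"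
    (is "?F \<longlonglongrightarrow> 0")
proof -
  note K = assms(2) and \<beta> = assms(6,7) and g_pos = assms(9) and ppp = assms(11) and lim = assms(12)
  have part: "partition (K n) (t n)" for n
    using assms(3-5) by unfold_locales
  have g: "integrable lborel g"
    using assms(8) by (simp add: has_bochner_integral_iff)
  obtain L where L: "\<And>x y. \<bar>g x - g y\<bar> \<le> L * \<bar>x - y\<bar> powr \<beta>"
    using assms(10) by (auto simp: hoelder_continuous_def)
  have L0: "0 \<le> L"
    using L[of 1 0] by simp
  have "continuous_on {- R..R + 1} g"
    by (rule hoelder_continuous_imp_continuous_on[OF assms(10) \<beta>(1)])
  \<comment> \<open>Off the exceptional event every \<open>a_hat\<close> lies within 1 above a level
    of absolute value at most \<open>R\<close>, hence in this compact interval. The minimum of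
    \<open>g\<close> there is positive and does not depend on \<open>n\<close>.\<close>
  then obtain x\<^sub>0 where x\<^sub>0: "\<forall>x\<in>{- R..R + 1}. g x\<^sub>0 \<le> g x"
    using continuous_attains_inf[of "{- R..R + 1}" g] \<open>R > 0\<close> by auto
  define c where "c = g x\<^sub>0"
  have c: "0 < c" "\<And>x. x \<in> {- R..R + 1} \<Longrightarrow> c \<le> g x"
    using g_pos x\<^sub>0 by (auto simp: c_def)
  define m where "m n = real n * (INF j\<in>{1..K n}. \<bar>t n j - t n (j - 1)\<bar>)" for n
  have m_le: "m n \<le> real n * (t n j - t n (j - 1))" if "j \<in> {1..K n}" for n j
  proof -
    have "(INF j\<in>{1..K n}. \<bar>t n j - t n (j - 1)\<bar>) \<le> \<bar>t n j - t n (j - 1)\<bar>"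
      using that by (intro cINF_lower) auto
    then show ?thesis
      using partition.t_step[OF part that] unfolding m_def by (intro mult_left_mono) auto
  qed
  have m_nonneg: "0 \<le> m n" for n
    unfolding m_def using K[of n] by (intro mult_nonneg_nonneg cINF_greatest) auto
  have m_1: "m n = real n" if "K n = 1" for n
    using assms(3)[of n] assms(4)[of n] that by (simp add: m_def)
  have m_ge: "eventually (\<lambda>n. 1 \<le> m n) sequentially"
    and Km: "(\<lambda>n. real (K n) * m n powr - \<beta>) \<longlonglongrightarrow> 0"
    using mesh_condition_tendsto[OF \<beta>(1) K m_nonneg m_1 lim[folded m_def]] by auto
  have "(\<lambda>n. 2 * L * (real (K n) * m n powr - \<beta>)) \<longlonglongrightarrow> 0"
    by (rule tendsto_mult_right_zero[OF Km])
  \<comment> \<open>The factor \<open>K n \<ge> 1\<close> only enlarges the left side, so this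
    yields the smallness condition on \<open>m n powr - \<beta>\<close> itself.\<close>
  then have "eventually (\<lambda>n. 2 * L * (real (K n) * m n powr - \<beta>) < c / 2) sequentially"
    using c(1) by (intro order_tendstoD(2)) auto
  then have bound: "eventually (\<lambda>n. ?F n \<le> ennreal ((1 + 8 * L / c) * (real (K n) * m n powr - \<beta>))) sequentially"
    using m_ge eventually_gt_at_top[of 0]
  proof eventually_elim
    case (elim n)
    have "1 * m n powr - \<beta> \<le> real (K n) * m n powr - \<beta>"
      using K[of n] by (intro mult_right_mono) auto
    then have "2 * L * m n powr - \<beta> \<le> 2 * L * (real (K n) * m n powr - \<beta>)"
      using L0 by (intro mult_left_mono) auto
    then have small: "2 * L * m n powr - \<beta> \<le> c / 2"
      using elim by linarith
    show ?case
      using partition.expected_tv_norm_le[OF part \<open>0 < n\<close> g g_pos \<beta> L0 L c \<open>1 \<le> m n\<close> m_le small _ ppp]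
        \<open>0 < n\<close>
      by (intro SUP_least)
  qed
  have bound_0: "(\<lambda>n. ennreal ((1 + 8 * L / c) * (real (K n) * m n powr - \<beta>))) \<longlonglongrightarrow> 0"
    using tendsto_ennrealI[OF tendsto_mult_right_zero[OF Km]] by simp
  show ?thesis
    by (rule tendsto_sandwich[OF _ bound tendsto_const bound_0]) simp
qed

end
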